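(* There is a Kleene index $e$ such that for every code $f$ of a Suslin set $P[f]\subseteq C$ (a $\Sigma_\alpha$- or $\Pi_\alpha$-code for some countable $\alpha$), the measure $\mathbf m(P[f])$ is computable in $\mathbf S$ and $f$ via $e$, in the sense that for every rational $q$, $\{e\}(\mathbf S,f,q)=0$ if $q<\mathbf m(P[f])$ and $=1$ otherwise (i.e. the Dedekind cut of $\mathbf m(P[f])$ is uniformly computable in $\mathbf S$ and $f$).
   Context: $C=\{0,1\}^{\mathbb N}$, $\mathbf m$ the completed uniform product measure on $C$. The Suslin functional: $\mathbf S(g)=0$ if $\forall f\in\mathbb N^{\mathbb N}\exists n\,g(\bar f(n))=0$, and $1$ if $\exists f\forall n\,g(\bar f(n))>0$, with $\bar f(n)=\langle f(0),\dots,f(n-1)\rangle$; computability is Kleene computability (S1–S9). Suslin sets: a Suslin scheme is $s\mapsto P_s$ on the set $\mathrm{SEQ}$ of finite sequences of naturals, $\mathbf A(\mathbf P)=\bigcup_f\bigcap_n P_{\bar f(n)}$; $\Sigma_0$ = clopen sets; $\Sigma_\alpha$ ($\alpha>0$) = sets $\mathbf A(\mathbf P)$ with each $P_s\in\Pi_\beta$, some $\beta<\alpha$; $\Pi_\alpha$ = complements; Suslin sets = $\bigcup_{\alpha<\omega_1}\Sigma_\alpha$. A code is a function in $\mathbb N^{\mathbb N}$ coding a well-founded labelled tree (leaves: clopen sets; inner nodes: complement, or $\mathbf A$ applied to the scheme of sets coded by children indexed by $\mathrm{SEQ}$); $P[f]$ is the coded set. All Suslin sets are $\mathbf m$-measurable.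 *)

theory Defs
  imports "HOL-Probability.Probability" "HOL-Library.Nat_Bijection"
begin

datatype obj = O0 nat | O1 "nat \<Rightarrow> nat" | O2 "(nat \<Rightarrow> nat) \<Rightarrow> nat"

datatype kidx =
    KSucc
  | KConst nat
  | KIdent
  | KComp kidx kidx
  | KPrimRec kidx kidx
  | KPerm nat kidx
  | KApp1
  | KApp2 kidx
  | KEnum

fun enc :: "kidx \<Rightarrow> nat" where
  "enc KSucc = prod_encode (0, 0)"
| "enc (KConst q) = prod_encode (1, q)"
| "enc KIdent = prod_encode (2, 0)"
| "enc (KComp a b) = prod_encode (3, prod_encode (enc a, enc b))"
| "enc (KPrimRec a b) = prod_encode (4, prod_encode (enc a, enc b))"
| "enc (KPerm i a) = prod_encode (5, prod_encode (i, enc a))"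
| "enc KApp1 = prod_encode (6, 0)"
| "enc (KApp2 a) = prod_encode (7, enc a)"
| "enc KEnum = prod_encode (8, 0)"

definition swap_at :: "nat \<Rightarrow> 'a list \<Rightarrow> 'a list" where
  "swap_at i xs = xs[i := xs ! Suc i, Suc i := xs ! i]"

inductive kc :: "kidx \<Rightarrow> obj list \<Rightarrow> nat \<Rightarrow> bool" where
  S1: "kc KSucc (O0 x # as) (Suc x)"
| S2: "kc (KConst q) as q"
| S3: "kc KIdent (O0 x # as) x"
| S4: "kc e2 as y \<Longrightarrow> kc e1 (O0 y # as) z \<Longrightarrow> kc (KComp e1 e2) as z"
| S5_0: "kc e1 as v \<Longrightarrow> kc (KPrimRec e1 e2) (O0 0 # as) v"
| S5_Suc: "kc (KPrimRec e1 e2) (O0 n # as) v \<Longrightarrow> kc e2 (O0 v # O0 n # as) w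
           \<Longrightarrow> kc (KPrimRec e1 e2) (O0 (Suc n) # as) w"
| S6: "Suc i < length as \<Longrightarrow> kc e (swap_at i as) v \<Longrightarrow> kc (KPerm i e) as v"
| S7: "kc KApp1 (O1 f # O0 x # as) (f x)"
| S8: "(\<forall>x. kc e1 (O0 x # O2 F # as) (g x)) \<Longrightarrow> kc (KApp2 e1) (O2 F # as) (F g)"
| S9: "kc e as v \<Longrightarrow> kc KEnum (O0 (enc e) # as) v"

definition kleene :: "nat \<Rightarrow> obj list \<Rightarrow> nat \<Rightarrow> bool" where
  "kleene x as v \<longleftrightarrow> (\<exists>e. enc e = x \<and> kc e as v)"

definition fbar :: "(nat \<Rightarrow> nat) \<Rightarrow> nat \<Rightarrow> nat" where
  "fbar f n = list_encode (map f [0..<n])"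

definition Suslin_S :: "(nat \<Rightarrow> nat) \<Rightarrow> nat" where
  "Suslin_S g = (if \<forall>f. \<exists>n. g (fbar f n) = 0 then 0 else 1)"

definition qdec :: "nat \<Rightarrow> rat" where
  "qdec n = (case prod_decode n of (a, b) \<Rightarrow>
     (case prod_decode a of (s, num) \<Rightarrow>
        (if s = 0 then 1 else -1) * of_nat num / of_nat (Suc b)))"

type_synonym cantor = "nat \<Rightarrow> bool"

definition cantor_measure :: "cantor measure" where
  "cantor_measure = completion (PiM UNIV (\<lambda>_. measure_pmf (bernoulli_pmf (1/2))))"

definition suslinA :: "(nat list \<Rightarrow> cantor set) \<Rightarrow> cantor set" where
  "suslinA P = (\<Union>f. \<Inter>n. P (map f [0..<n]))"

definition cylinder :: "nat list \<Rightarrow> cantor set" where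
  "cylinder s = {x. \<forall>i<length s. x i = (s ! i \<noteq> 0)}"

definition clopen_code :: "nat \<Rightarrow> cantor set" where
  "clopen_code k = (\<Union>s\<in>set (list_decode k). cylinder (list_decode s))"

text \<open>\<open>codes f \<sigma> A\<close>: the (well-founded) labelled subtree of f at node \<sigma> codes A.
  Labels f(\<langle>\<sigma>\<rangle>): Suc(2k) = leaf with clopen set k; 2 = complement (child \<sigma>@[0]);
  4 = Suslin operation A (children \<sigma>@[\<langle>s\<rangle>], s \<in> SEQ).\<close>
inductive codes :: "(nat \<Rightarrow> nat) \<Rightarrow> nat list \<Rightarrow> cantor set \<Rightarrow> bool" for f where
  leaf: "f (list_encode \<sigma>) = Suc (2 * k) \<Longrightarrow> codes f \<sigma> (clopen_code k)"
| compl: "f (list_encode \<sigma>) = 2 \<Longrightarrow> codes f (\<sigma> @ [0]) A \<Longrightarrow> codes f \<sigma> (- A)"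
| susl: "f (list_encode \<sigma>) = 4 \<Longrightarrow> (\<forall>s. codes f (\<sigma> @ [list_encode s]) (P s))
          \<Longrightarrow> codes f \<sigma> (suslinA P)"

end

theory Submission
  imports Defs
begin

text \<open>
  For a coded set \<open>A\<close> the relation ``\<open>\<mu>(C - A) < q\<close>'' between clopen sets \<open>C\<close> and rationals \<open>q\<close>
  is decided by recursion on the code.
  At a leaf it is a count of binary words.  For a complement, \<open>\<mu>(C - (- A)) < q\<close> holds iff
  some rational \<open>q'\<close> satisfies \<open>\<mu>(C - A) \<ge> q'\<close> and \<open>\<mu> C < q' + q\<close>.
  For \<open>A = \<Union>f. \<Inter>n. P\<^bsub>f|n\<^esub>\<close>, it holds iff there are \<open>j\<close>, bounds \<open>H\<close> and clopen sets
  \<open>D\<^bsub>s\<^esub>\<close>, almost contained in \<open>P\<^bsub>s\<^esub>\<close> with total error below \<open>2\<^bsup>-j\<^esup>\<close>, such that every finite stage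
  of the tree of sequences whose codes are bounded by \<open>H\<close>, evaluated with \<open>D\<close> in place of \<open>P\<close>,
  exhausts \<open>C\<close> up to less than \<open>q - 2\<^bsup>-j\<^esup>\<close>.  Sufficiency is Koenig's lemma; for necessity, \<open>H\<close> is
  found by continuity from below of the outer measure, which also gives the measurability of \<open>A\<close>.
  Both inner clauses have the form \<open>\<exists>g. \<forall>n. R (g|n)\<close>, where \<open>R\<close> asks one question about a child,
  so each costs one application of the Suslin functional.
\<close>

section \<open>Computation on numbers\<close>

text \<open>The arbitrary tail \<open>as\<close> lets a program run in front of any further
  arguments. S4 only prepends values, so leftover arguments never have to be removed.\<close>

definition K1 :: "(nat \<Rightarrow> nat) \<Rightarrow> bool" where
  "K1 g \<longleftrightarrow> (\<exists>e. \<forall>x as. kc e (O0 x # as) (g x))"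

definition K2 :: "(nat \<Rightarrow> nat \<Rightarrow> nat) \<Rightarrow> bool" where
  "K2 g \<longleftrightarrow> (\<exists>e. \<forall>x y as. kc e (O0 x # O0 y # as) (g x y))"

definition K3 :: "(nat \<Rightarrow> nat \<Rightarrow> nat \<Rightarrow> nat) \<Rightarrow> bool" where
  "K3 g \<longleftrightarrow> (\<exists>e. \<forall>x y z as. kc e (O0 x # O0 y # O0 z # as) (g x y z))"

text \<open>S6 with the swapped list as a separate equation: in backward use the inner program
  determines \<open>bs\<close>, and evaluating \<open>swap_at\<close> checks the equation
  afterwards.\<close>

lemma kc_perm: "kc e bs v \<Longrightarrow> Suc i < length as \<Longrightarrow> swap_at i as = bs \<Longrightarrow> kc (KPerm i e) as v"
  using S6 by blast

lemma K1_id: "K1 (\<lambda>x. x)"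
  unfolding K1_def using S3 by blast

lemma K1_const: "K1 (\<lambda>x. c)"
  unfolding K1_def using S2 by blast

lemma K1_Suc: "K1 Suc"
  unfolding K1_def using S1 by blast

lemma K1_comp: "K1 g \<Longrightarrow> K1 h \<Longrightarrow> K1 (\<lambda>x. g (h x))"
  unfolding K1_def by (blast intro: S4)

lemma K2_comp:
  assumes "K2 F" "K1 a" "K1 b"
  shows "K1 (\<lambda>x. F (a x) (b x))"
proof -
  obtain eF ea eb where
    e: "\<And>x y as. kc eF (O0 x # O0 y # as) (F x y)" "\<And>x as. kc ea (O0 x # as) (a x)"
       "\<And>x as. kc eb (O0 x # as) (b x)"
    using assms unfolding K1_def K2_def by blast
  \<comment> \<open>\<open>b x\<close> is computed first and lands in front; a swap returns
    \<open>x\<close> to the front for \<open>ea\<close>, and a second one puts \<open>b x\<close>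
    right behind \<open>a x\<close>.\<close>
  have "kc (KComp (KPerm 0 (KComp (KPerm 1 eF) ea)) eb) (O0 x # as) (F (a x) (b x))" for x as
    by (rule S4[OF e(3)], rule kc_perm, rule S4[OF e(2)], rule kc_perm, rule e(1))
       (simp_all add: swap_at_def)
  then show ?thesis unfolding K1_def by blast
qed

lemma K3_comp2:
  assumes "K2 F" "K3 a" "K3 b"
  shows "K3 (\<lambda>x y z. F (a x y z) (b x y z))"
proof -
  obtain eF ea eb where
    e: "\<And>x y as. kc eF (O0 x # O0 y # as) (F x y)"
       "\<And>x y z as. kc ea (O0 x # O0 y # O0 z # as) (a x y z)"
       "\<And>x y z as. kc eb (O0 x # O0 y # O0 z # as) (b x y z)"
    using assms unfolding K3_def K2_def by metis
  \<comment> \<open>As in the unary case, but the value of \<open>b\<close> has to travel past three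
    arguments and back.\<close>
  have "kc (KComp (KPerm 0 (KPerm 1 (KPerm 2 (KComp (KPerm 3 (KPerm 2 (KPerm 1 eF))) ea)))) eb)
          (O0 x # O0 y # O0 z # as) (F (a x y z) (b x y z))" for x y z as
    by (rule S4[OF e(3)], rule kc_perm, rule kc_perm, rule kc_perm, rule S4[OF e(2)],
        rule kc_perm, rule kc_perm, rule kc_perm, rule e(1))
       (simp_all add: swap_at_def numeral_2_eq_2 numeral_3_eq_3)
  then show ?thesis unfolding K3_def by blast
qed

lemma K3_comp1: "K1 g \<Longrightarrow> K3 a \<Longrightarrow> K3 (\<lambda>x y z. g (a x y z))"
  unfolding K3_def K1_def by (blast intro: S4)

lemma K3_x: "K3 (\<lambda>x y z. x)"
  unfolding K3_def using S3 by blast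

lemma K3_y: "K3 (\<lambda>x y z. y)"
  unfolding K3_def
  by (rule exI[of _ "KPerm 0 KIdent"]) (auto intro!: kc_perm[OF S3] simp: swap_at_def)

lemma K3_z: "K3 (\<lambda>x y z. z)"
proof -
  have "kc (KPerm 1 (KPerm 0 KIdent)) (O0 x # O0 y # O0 z # as) z" for x y z as
    by (rule kc_perm, rule kc_perm, rule S3) (simp_all add: swap_at_def)
  then show ?thesis unfolding K3_def by blast
qed

lemma K2_if_K3: "K3 (\<lambda>x y z. g y z) \<Longrightarrow> K2 g"
proof -
  assume "K3 (\<lambda>x y z. g y z)"
  then obtain e where e: "\<And>x y z as. kc e (O0 x # O0 y # O0 z # as) (g y z)"
    unfolding K3_def by blast
  have "kc (KComp e (KConst 0)) (O0 y # O0 z # as) (g y z)" for y z as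
    by (rule S4[OF S2 e])
  then show ?thesis unfolding K2_def by blast
qed

lemma K2_swap:
  assumes "K2 F" shows "K2 (\<lambda>x y. F y x)"
  using assms K3_comp2[OF _ K3_z K3_y] by (intro K2_if_K3) auto

lemma K2_rec:
  assumes "K1 g" "K3 s"
  shows "K2 (\<lambda>n x. rec_nat (g x) (\<lambda>n v. s v n x) n)"
proof -
  obtain eg es where e: "\<And>x as. kc eg (O0 x # as) (g x)"
     "\<And>x y z as. kc es (O0 x # O0 y # O0 z # as) (s x y z)"
    using assms unfolding K1_def K3_def by metis
  have "kc (KPrimRec eg es) (O0 n # O0 x # as) (rec_nat (g x) (\<lambda>n v. s v n x) n)" for n x as
    by (induction n) (auto intro: S5_0 S5_Suc e)
  then show ?thesis unfolding K2_def by blast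
qed

lemma K1_diag: "K2 F \<Longrightarrow> K1 (\<lambda>x. F x x)"
  using K2_comp K1_id by blast

lemma K2_add: "K2 (+)"
proof -
  have "rec_nat x (\<lambda>n. Suc) n = n + x" for n x :: nat by (induction n) auto
  with K2_rec[OF K1_id K3_comp1[OF K1_Suc K3_x]] show ?thesis by simp
qed

lemma K1_pred: "K1 (\<lambda>x. x - 1)"
proof -
  have "rec_nat 0 (\<lambda>n v. n) n = n - 1" for n :: nat by (cases n) auto
  with K1_diag[OF K2_rec[OF K1_const[of 0] K3_y]] show ?thesis by simp
qed

lemma K2_diff: "K2 (-)"
proof -
  have "rec_nat x (\<lambda>n v. v - 1) n = x - n" for n x :: nat by (induction n) auto
  with K2_swap[OF K2_rec[OF K1_id K3_comp1[OF K1_pred K3_x]]] show ?thesis by simp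
qed

lemma K2_mult: "K2 (*)"
proof -
  have "rec_nat 0 (\<lambda>n v. v + x) n = n * x" for n x :: nat by (induction n) auto
  with K2_rec[OF K1_const[of 0] K3_comp2[OF K2_add K3_x K3_z]] show ?thesis by simp
qed

lemma K1_triangle: "K1 triangle"
proof -
  have "rec_nat 0 (\<lambda>n v. v + Suc n) n = triangle n" for n by (induction n) auto
  with K1_diag[OF K2_rec[OF K1_const[of 0] K3_comp2[OF K2_add K3_x K3_comp1[OF K1_Suc K3_y]]]]
  show ?thesis by simp
qed

section \<open>Cantor pairing and its inverses\<close>

abbreviation pair :: "nat \<Rightarrow> nat \<Rightarrow> nat" where "pair x y \<equiv> prod_encode (x, y)"

definition p1 :: "nat \<Rightarrow> nat" where "p1 n = fst (prod_decode n)"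
definition p2 :: "nat \<Rightarrow> nat" where "p2 n = snd (prod_decode n)"

lemma p_pair [simp]: "p1 (pair x y) = x" "p2 (pair x y) = y" "pair (p1 n) (p2 n) = n"
  by (simp_all add: p1_def p2_def)

lemma K2_pair: "K2 pair"
proof -
  have "K2 (\<lambda>x y. triangle (x + y) + x)"
    by (intro K2_if_K3 K3_comp2[OF K2_add] K3_comp1[OF K1_triangle] K3_y K3_z)
  then show ?thesis by (simp add: prod_encode_def)
qed

lemma triangle_mono: "m \<le> n \<Longrightarrow> triangle m \<le> triangle n"
  by (induction rule: dec_induct) auto

definition prow :: "nat \<Rightarrow> nat" where "prow n = p1 n + p2 n"

text \<open>The diagonal \<open>s\<close> containing \<open>n\<close> satisfies triangle s \<le> n <
  triangle (s + 1), so \<open>s\<close> counts the \<open>i\<close> with triangle (i + 1) \<le> n.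
  As s \<le> n, a sum over i < n finds it without unbounded search; truncated subtraction yields the
  truth value.\<close>

lemma prow_eq_sum: "prow n = rec_nat 0 (\<lambda>i v. v + (1 - (triangle (Suc i) - n))) n"
proof -
  define s where "s = prow n"
  have n: "n = triangle s + p1 n"
    using p_pair(3)[of n] unfolding s_def prow_def prod_encode_def by simp
  have le: "p1 n \<le> s" unfolding s_def prow_def by simp
  have 1: "triangle (Suc i) \<le> n \<longleftrightarrow> i < s" for i
  proof
    assume "triangle (Suc i) \<le> n"
    show "i < s"
    proof (rule ccontr)
      assume "\<not> i < s"
      then have "triangle (Suc s) \<le> triangle (Suc i)" by (intro triangle_mono) simp
      with \<open>triangle (Suc i) \<le> n\<close> n le show False by simp
    qed
  next
    assume "i < s"
    then have "triangle (Suc i) \<le> triangle s" by (intro triangle_mono) simp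
    then show "triangle (Suc i) \<le> n" using n by simp
  qed
  have eq: "1 - (triangle (Suc i) - n) = of_bool (i < s)" for i
    using 1[of i] by (auto simp del: triangle_Suc)
  have 2: "rec_nat 0 (\<lambda>i v. v + (1 - (triangle (Suc i) - n))) k = min k s" for k
    by (induction k) (auto simp: eq simp del: triangle_Suc One_nat_def)
  have "k \<le> triangle k" for k by (induction k) auto
  from this[of s] n have "s \<le> n" by linarith
  with 2[of n] show ?thesis unfolding s_def by simp
qed

lemma K1_prow: "K1 prow"
proof -
  have "K2 (\<lambda>m n. rec_nat 0 (\<lambda>i v. v + (1 - (triangle (Suc i) - n))) m)"
    by (intro K2_rec K1_const K3_comp2[OF K2_add] K3_comp2[OF K2_diff] K3_comp1[OF K1_triangle]
         K3_comp1[OF K1_Suc] K3_x K3_y K3_z K3_comp1[OF K1_const, of "\<lambda>x y z. z"])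
  note K1_diag[OF this]
  moreover have "prow = (\<lambda>n. rec_nat 0 (\<lambda>i v. v + (1 - (triangle (Suc i) - n))) n)"
    by (rule ext) (rule prow_eq_sum)
  ultimately show ?thesis by (simp only:)
qed

lemma K1_p1: "K1 p1"
proof -
  have "p1 n = n - triangle (prow n)" for n
    using p_pair(3)[of n] unfolding prow_def prod_encode_def by simp
  then have "p1 = (\<lambda>n. n - triangle (prow n))" by (rule ext)
  with K2_comp[OF K2_diff K1_id K1_comp[OF K1_triangle K1_prow]] show ?thesis by (simp only:)
qed

lemma K1_p2: "K1 p2"
proof -
  have "p2 n = prow n - p1 n" for n unfolding prow_def by simp
  then have "p2 = (\<lambda>n. prow n - p1 n)" by (rule ext)
  with K2_comp[OF K2_diff K1_prow K1_p1] show ?thesis by (simp only:)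
qed

text \<open>Several arguments are packed into one by pairing, so that all further closure rules can
  be stated for unary functions.\<close>

lemma K2I: "K1 (\<lambda>y. F (p1 y) (p2 y)) \<Longrightarrow> K2 F"
  using K2_if_K3[OF K3_comp1[OF _ K3_comp2[OF K2_pair K3_y K3_z]]] by force

lemma K3I: "K1 (\<lambda>y. F (p1 y) (p1 (p2 y)) (p2 (p2 y))) \<Longrightarrow> K3 F"
  using K3_comp1[OF _ K3_comp2[OF K2_pair K3_x K3_comp2[OF K2_pair K3_y K3_z]]] by force

section \<open>Closure properties of computable functions and decidable predicates\<close>

named_theorems krec

lemmas [krec] = K1_id K1_const K1_comp[OF K1_Suc] K2_comp[OF K2_add] K2_comp[OF K2_diff]
  K2_comp[OF K2_mult] K2_comp[OF K2_pair] K1_comp[OF K1_p1] K1_comp[OF K1_p2] K1_comp[OF K1_pred]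

lemma K1_rec [krec]:
  assumes "K1 a" "K1 b" "K1 (\<lambda>y. s (p1 (p2 y)) (p1 y) (p2 (p2 y)))"
  shows "K1 (\<lambda>x. rec_nat (a x) (\<lambda>n v. s n v x) (b x))"
proof -
  have "K3 (\<lambda>v n x. s n v x)" by (rule K3I) (rule assms(3))
  from K2_comp[OF K2_rec[OF assms(1) this] assms(2) K1_id] show ?thesis by simp
qed

abbreviation KP :: "(nat \<Rightarrow> bool) \<Rightarrow> bool" where "KP P \<equiv> K1 (\<lambda>x. of_bool (P x))"

lemma KP_le [krec]: "K1 a \<Longrightarrow> K1 b \<Longrightarrow> KP (\<lambda>x. a x \<le> b x)"
proof -
  assume a: "K1 a" "K1 b"
  have "of_bool (m \<le> n) = 1 - (m - n)" for m n :: nat by auto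
  then show ?thesis by (simp only:) (intro krec a)
qed

lemma KP_less [krec]: "K1 a \<Longrightarrow> K1 b \<Longrightarrow> KP (\<lambda>x. a x < b x)"
  unfolding less_eq_Suc_le by (intro krec)

lemma KP_not [krec]: "KP P \<Longrightarrow> KP (\<lambda>x. \<not> P x)"
proof -
  assume a: "KP P"
  have eq: "of_bool (\<not> Q) = 1 - (of_bool Q :: nat)" for Q by auto
  show ?thesis unfolding eq by (intro krec a)
qed

lemma KP_conj [krec]: "KP P \<Longrightarrow> KP Q \<Longrightarrow> KP (\<lambda>x. P x \<and> Q x)"
  unfolding of_bool_conj by (intro krec)

lemma KP_imp [krec]: "KP P \<Longrightarrow> KP Q \<Longrightarrow> KP (\<lambda>x. P x \<longrightarrow> Q x)"
proof -
  assume a: "KP P" "KP Q"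
  have eq: "(A \<longrightarrow> B) \<longleftrightarrow> \<not> (A \<and> \<not> B)" for A B by auto
  show ?thesis unfolding eq by (intro KP_not KP_conj a)
qed

lemma KP_disj [krec]: "KP P \<Longrightarrow> KP Q \<Longrightarrow> KP (\<lambda>x. P x \<or> Q x)"
proof -
  assume a: "KP P" "KP Q"
  have eq: "(A \<or> B) \<longleftrightarrow> (\<not> A \<longrightarrow> B)" for A B by auto
  show ?thesis unfolding eq by (intro KP_not KP_imp a)
qed

lemma KP_iff [krec]: "KP P \<Longrightarrow> KP Q \<Longrightarrow> KP (\<lambda>x. P x \<longleftrightarrow> Q x)"
proof -
  assume a: "KP P" "KP Q"
  have eq: "(A \<longleftrightarrow> B) \<longleftrightarrow> (A \<longrightarrow> B) \<and> (B \<longrightarrow> A)" for A B by auto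
  show ?thesis unfolding eq by (intro KP_conj KP_imp a)
qed

lemma KP_eq [krec]: "K1 a \<Longrightarrow> K1 b \<Longrightarrow> KP (\<lambda>x. a x = b x)"
  unfolding order.eq_iff by (intro krec)

lemma K1_if [krec]:
  assumes "KP P" "K1 a" "K1 b"
  shows "K1 (\<lambda>x. if P x then a x else b x)"
proof -
  have "(\<lambda>x. if P x then a x else b x) = (\<lambda>x. of_bool (P x) * a x + of_bool (\<not> P x) * b x)"
    by auto
  then show ?thesis by (simp only:) (intro krec assms)
qed

lemma K1_sum [krec]:
  assumes "K1 b" "K1 (\<lambda>y. g (p1 y) (p2 y))"
  shows "K1 (\<lambda>x. \<Sum>i<b x. g i x)"
proof -
  have eq: "(\<Sum>i<n. g i x) = rec_nat 0 (\<lambda>i v. v + g i x) n" for n x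
    by (induction n) auto
  show ?thesis unfolding eq
    by (intro krec assms K2_comp[OF K2I[of g]])
qed

text \<open>The quantifier holds iff the number of counterexamples below the bound is zero.\<close>

lemma KP_all [krec]:
  assumes "K1 b" "KP (\<lambda>y. P (p1 y) (p2 y))"
  shows "KP (\<lambda>x. \<forall>i<b x. P i x)"
proof -
  have eq: "(\<forall>i<n. P i x) \<longleftrightarrow> (\<Sum>i<n. of_bool (\<not> P i x)) = (0::nat)" for n x
    by (auto simp: sum_eq_0_iff)
  show ?thesis unfolding eq by (intro krec assms)
qed

lemma KP_ex [krec]:
  assumes "K1 b" "KP (\<lambda>y. P (p1 y) (p2 y))"
  shows "KP (\<lambda>x. \<exists>i<b x. P i x)"
proof -
  have eq: "(\<exists>i<n. P i x) \<longleftrightarrow> \<not> (\<forall>i<n. \<not> P i x)" for n x by auto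
  show ?thesis unfolding eq by (intro krec assms)
qed

lemma K1_funpow [krec]:
  assumes "K1 F" "K1 b" "K1 a"
  shows "K1 (\<lambda>x. (F ^^ b x) (a x))"
proof -
  have eq: "(F ^^ n) x = rec_nat x (\<lambda>_ v. F v) n" for n x
    by (induction n) auto
  show ?thesis unfolding eq by (intro krec assms K1_comp[OF assms(1)])
qed

lemma K1_power2 [krec]: "K1 b \<Longrightarrow> K1 (\<lambda>x. 2 ^ b x)"
proof -
  assume b: "K1 b"
  have eq: "(2::nat) ^ n = rec_nat 1 (\<lambda>_ v. v + v) n" for n :: nat
    by (induction n) auto
  show ?thesis unfolding eq by (intro krec b)
qed

lemma KP_odd [krec]: "K1 b \<Longrightarrow> KP (\<lambda>x. odd (b x))"
proof -
  assume b: "K1 b"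
  have eq: "of_bool (odd n) = rec_nat (0::nat) (\<lambda>_ v. 1 - v) n" for n :: nat
    by (induction n) auto
  show ?thesis unfolding eq by (intro krec b)
qed

text \<open>The quotient counts the positive multiples of the divisor up to the dividend.\<close>

lemma K1_div [krec]:
  assumes "K1 a" "K1 b"
  shows "K1 (\<lambda>x. a x div b x)"
proof -
  have eq: "m div n = (if n = 0 then 0 else \<Sum>i<m. of_bool (Suc i * n \<le> m))" for m n :: nat
  proof (cases "n = 0")
    case False
    have 1: "Suc i * n \<le> m \<longleftrightarrow> i < m div n" for i
      using False less_eq_div_iff_mult_less_eq[of n "Suc i" m] by (simp only: Suc_le_eq)
    have "(\<Sum>i<k. of_bool (i < m div n)) = min k (m div n)" for k
      by (induction k) auto
    moreover have "min m (m div n) = m div n" by (rule min.absorb2) simp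
    ultimately show ?thesis using False unfolding 1 by presburger
  qed simp
  show ?thesis unfolding eq
    by (intro krec assms K1_comp[OF assms(1)] K1_comp[OF assms(2)])
qed

section \<open>Coded lists and numeric recursion\<close>

definition tl_code :: "nat \<Rightarrow> nat" where "tl_code n = p2 (n - 1)"
definition hd_code :: "nat \<Rightarrow> nat" where "hd_code n = p1 (n - 1)"
definition len_code :: "nat \<Rightarrow> nat" where "len_code n = length (list_decode n)"
definition nth_code :: "nat \<Rightarrow> nat \<Rightarrow> nat" where
  "nth_code n i = (if i < len_code n then list_decode n ! i else 0)"
definition snoc_code :: "nat \<Rightarrow> nat \<Rightarrow> nat" where
  "snoc_code n a = list_encode (list_decode n @ [a])"

lemma list_decode_Suc_p: "list_decode (Suc n) = p1 n # list_decode (p2 n)"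
  by (simp add: p1_def p2_def split: prod.split)

lemma p_zero [simp]: "p1 0 = 0" "p2 0 = 0"
proof -
  have "pair 0 0 = 0" by (simp add: prod_encode_def)
  then show "p1 0 = 0" "p2 0 = 0" using p_pair(1,2)[of 0 0] by simp_all
qed

lemma list_decode_tl_code: "list_decode (tl_code n) = tl (list_decode n)"
  by (cases n) (simp_all add: tl_code_def list_decode_Suc_p del: list_decode.simps(2))

lemma list_decode_tl_code_pow: "list_decode ((tl_code ^^ i) n) = drop i (list_decode n)"
  by (induction i) (simp_all add: list_decode_tl_code drop_Suc tl_drop)

lemma hd_code_eq: "hd_code n = (case list_decode n of [] \<Rightarrow> 0 | a # _ \<Rightarrow> a)"
  by (cases n) (simp_all add: hd_code_def list_decode_Suc_p del: list_decode.simps(2))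

lemma list_decode_eq_Nil: "list_decode n = [] \<longleftrightarrow> n = 0"
  by (cases n) (simp_all add: list_decode_Suc_p del: list_decode.simps(2))

text \<open>Valid also beyond the end of the list, where both sides are the default value 0.\<close>

lemma nth_code_alt: "nth_code n i = hd_code ((tl_code ^^ i) n)"
proof (cases "i < len_code n")
  case True
  then have "drop i (list_decode n) = list_decode n ! i # drop (Suc i) (list_decode n)"
    by (simp add: len_code_def Cons_nth_drop_Suc)
  with True show ?thesis by (simp add: nth_code_def hd_code_eq list_decode_tl_code_pow)
qed (simp add: nth_code_def hd_code_eq list_decode_tl_code_pow len_code_def)

lemma len_code_le: "len_code n \<le> n"
proof -
  have "length xs \<le> list_encode xs" for xs
  proof (induction xs)
    case (Cons a xs)
    then show ?case using le_prod_encode_2[of "list_encode xs" a] by simp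
  qed simp
  from this[of "list_decode n"] show ?thesis by (simp add: len_code_def)
qed

text \<open>The length is the number of nonempty tails, and the code itself bounds how many tails
  have to be inspected.\<close>

lemma len_code_alt: "len_code n = (\<Sum>i<n. of_bool ((tl_code ^^ i) n \<noteq> 0))"
proof -
  have 1: "(tl_code ^^ i) n \<noteq> 0 \<longleftrightarrow> i < len_code n" for i
    unfolding list_decode_eq_Nil[symmetric] list_decode_tl_code_pow len_code_def by auto
  have "(\<Sum>i<k. of_bool (i < len_code n)) = min k (len_code n)" for k
    by (induction k) auto
  with len_code_le[of n] show ?thesis unfolding 1 by (simp add: min_absorb2)
qed

lemma nth_code_le: "nth_code n i \<le> n"
proof -
  have *: "a \<in> set xs \<Longrightarrow> a \<le> list_encode xs" for a xs
  proof (induction xs)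
    case (Cons b xs)
    then show ?case using le_prod_encode_1[of b "list_encode xs"] le_prod_encode_2[of "list_encode xs" b]
      by auto
  qed simp
  show ?thesis
    using *[of "list_decode n ! i" "list_decode n"] by (auto simp: nth_code_def len_code_def)
qed

lemma K1_tl_code: "K1 tl_code" unfolding tl_code_def[abs_def] by (intro krec)

lemma K1_hd_code: "K1 hd_code" unfolding hd_code_def[abs_def] by (intro krec)

lemma K1_nth_code [krec]: "K1 a \<Longrightarrow> K1 b \<Longrightarrow> K1 (\<lambda>x. nth_code (a x) (b x))"
  unfolding nth_code_alt by (intro krec K1_comp[OF K1_hd_code] K1_tl_code)

lemma K1_len_code [krec]: "K1 a \<Longrightarrow> K1 (\<lambda>x. len_code (a x))"
proof -
  have "K1 len_code" unfolding len_code_alt[abs_def] by (intro krec K1_tl_code)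
  then show "K1 a \<Longrightarrow> K1 (\<lambda>x. len_code (a x))" by (rule K1_comp)
qed

text \<open>The state pairs an accumulator with the rest of the list. Finished states are fixed, so
  any sufficiently large number of iterations reverses the list; reversal is what makes appending at
  the end computable.\<close>

definition rev_step :: "nat \<Rightarrow> nat" where
  "rev_step s = (if p2 s = 0 then s else pair (Suc (pair (hd_code (p2 s)) (p1 s))) (tl_code (p2 s)))"

lemma rev_step_pow:
  "length xs \<le> k \<Longrightarrow>
     (rev_step ^^ k) (pair (list_encode ys) (list_encode xs)) = pair (list_encode (rev xs @ ys)) 0"
proof (induction xs arbitrary: ys k)
  case Nil
  have "(rev_step ^^ k) (pair (list_encode ys) 0) = pair (list_encode ys) 0"
    by (induction k) (simp_all add: rev_step_def)
  then show ?case by simp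
next
  case (Cons x xs)
  then obtain k' where k: "k = Suc k'" "length xs \<le> k'" by (cases k) auto
  have "rev_step (pair (list_encode ys) (list_encode (x # xs)))
      = pair (list_encode (x # ys)) (list_encode xs)"
    by (simp add: rev_step_def hd_code_def tl_code_def)
  with Cons.IH[OF k(2), of "x # ys"] show ?case
    unfolding k funpow_Suc_right o_apply by simp
qed

definition rev_code :: "nat \<Rightarrow> nat" where "rev_code n = list_encode (rev (list_decode n))"

lemma rev_code_alt: "rev_code n = p1 ((rev_step ^^ n) (pair 0 n))"
  using rev_step_pow[of "list_decode n" n "[]"] len_code_le[of n] by (simp add: rev_code_def len_code_def)

lemma K1_rev_code: "K1 rev_code"
proof -
  have "K1 rev_step" unfolding rev_step_def[abs_def] by (intro krec K1_comp[OF K1_hd_code] K1_comp[OF K1_tl_code])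
  then show ?thesis unfolding rev_code_alt[abs_def] by (intro krec)
qed

lemma K1_snoc_code [krec]: "K1 a \<Longrightarrow> K1 b \<Longrightarrow> K1 (\<lambda>x. snoc_code (a x) (b x))"
proof -
  have eq: "snoc_code n a = rev_code (Suc (pair a (rev_code n)))" for n a
    by (simp add: snoc_code_def rev_code_def)
  show "K1 a \<Longrightarrow> K1 b \<Longrightarrow> K1 (\<lambda>x. snoc_code (a x) (b x))"
    unfolding eq by (intro krec K1_comp[OF K1_rev_code])
qed

section \<open>Binary words as points, and decidable membership\<close>

definition bits :: "nat \<Rightarrow> cantor" where "bits w i = odd (w div 2 ^ i)"

lemma mem_clopen_code:
  "x \<in> clopen_code k \<longleftrightarrow>
     (\<exists>j<len_code k. \<forall>i<len_code (nth_code k j). x i \<longleftrightarrow> nth_code (nth_code k j) i \<noteq> 0)"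
  by (auto simp: clopen_code_def cylinder_def set_conv_nth len_code_def nth_code_def)

definition prefix_code :: "nat \<Rightarrow> nat \<Rightarrow> bool" where
  "prefix_code v u \<longleftrightarrow> len_code v \<le> len_code u \<and> (\<forall>j<len_code v. nth_code v j = nth_code u j)"

text \<open>A finite initial segment \<open>t\<close> of a witness \<open>g\<close> has \<open>g 0 = j\<close> and \<open>g (Suc i) = \<langle>H i, D i\<rangle>\<close>; clopen sets
  \<open>D v\<close> that \<open>t\<close> does not yet specify count as the whole space, so that the stages decrease.\<close>
definition stage_set :: "nat \<Rightarrow> cantor set" where
  "stage_set t = {x. \<exists>u<t. Suc (Suc (len_code u)) = len_code t \<and>
     (\<forall>v<Suc u. prefix_code v u \<longrightarrow> v < p1 (nth_code t (Suc (len_code v))) \<and>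
        (Suc v < len_code t \<longrightarrow> x \<in> clopen_code (p2 (nth_code t (Suc v)))))}"

text \<open>If \<open>X\<close> depends on the first \<open>R\<close> coordinates only, this is 2^R
  times its measure; see \<open>measure_depends_on\<close>.\<close>

definition word_count :: "nat \<Rightarrow> cantor set \<Rightarrow> nat" where
  "word_count R X = (\<Sum>w<2 ^ R. of_bool (bits w \<in> X))"

lemma KP_clopen2: "K2 (\<lambda>k w. of_bool (bits w \<in> clopen_code k))"
  by (rule K2I) (unfold mem_clopen_code bits_def, intro krec)

lemma KP_comp2: "K2 (\<lambda>k w. of_bool (P k w)) \<Longrightarrow> K1 a \<Longrightarrow> K1 b \<Longrightarrow> KP (\<lambda>x. P (a x) (b x))"
  by (rule K2_comp)

lemmas KP_clopen [krec] = KP_comp2[OF KP_clopen2]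

lemma KP_prefix_code [krec]: "K1 a \<Longrightarrow> K1 b \<Longrightarrow> KP (\<lambda>x. prefix_code (a x) (b x))"
  by (rule KP_comp2[where P = prefix_code], rule K2I) (unfold prefix_code_def, intro krec)

text \<open>Every quantifier in \<open>stage_set\<close> is bounded by \<open>t\<close>, by
  \<open>u\<close> or by a length, so membership of a point \<open>bits w\<close> is
  decidable.\<close>

lemma KP_stage_set [krec]: "K1 a \<Longrightarrow> K1 b \<Longrightarrow> KP (\<lambda>x. bits (b x) \<in> stage_set (a x))"
  by (rule KP_comp2[where P = "\<lambda>t w. bits w \<in> stage_set t"], rule K2I)
     (unfold stage_set_def mem_Collect_eq, intro krec)

section \<open>Programs relative to the Suslin functional and a function\<close>

definition computes :: "kidx \<Rightarrow> (nat \<Rightarrow> nat) \<Rightarrow> nat \<Rightarrow> nat \<Rightarrow> bool" where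
  "computes e f x v \<longleftrightarrow> (\<forall>as. kc e (O0 x # O2 Suslin_S # O1 f # as) v)"

lemma computes_K1: "K1 g \<Longrightarrow> \<exists>e. \<forall>f x. computes e f x (g x)"
  unfolding K1_def computes_def by blast

text \<open>The old input is moved behind \<open>f\<close> into the ignored tail. The index is
  chosen before the convergence hypotheses, so it is uniform and the component programs may be
  partial.\<close>

lemma computes_comp: "\<exists>e. \<forall>f x y v. computes e1 f x y \<longrightarrow> computes e2 f y v \<longrightarrow> computes e f x v"
proof -
  have "computes (KComp (KPerm 1 (KPerm 2 e2)) e1) f x v" if a: "computes e1 f x y" "computes e2 f y v" for f x y v
    unfolding computes_def
  proof
    fix as
    show "kc (KComp (KPerm 1 (KPerm 2 e2)) e1) (O0 x # O2 Suslin_S # O1 f # as) v"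
      by (rule S4[OF a(1)[unfolded computes_def, rule_format]], rule kc_perm, rule kc_perm,
          rule a(2)[unfolded computes_def, rule_format, of "O0 x # as"])
         (simp_all add: swap_at_def numeral_2_eq_2)
  qed
  then show ?thesis by blast
qed

lemma computes_comp_pair: "\<exists>e. \<forall>f x y v. computes e1 f x y \<longrightarrow> computes e2 f (pair y x) v \<longrightarrow> computes e f x v"
proof -
  obtain ep where ep: "\<And>x y as. kc ep (O0 x # O0 y # as) (pair x y)"
    using K2_pair unfolding K2_def by blast
  let ?e = "KComp (KComp (KPerm 2 (KPerm 1 (KPerm 3 (KPerm 2 e2)))) ep) e1"
  have "computes ?e f x v" if a: "computes e1 f x y" "computes e2 f (pair y x) v" for f x y v
    unfolding computes_def
  proof
    fix as
    show "kc ?e (O0 x # O2 Suslin_S # O1 f # as) v"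
      by (rule S4[OF a(1)[unfolded computes_def, rule_format]], rule S4[OF ep],
          rule kc_perm, rule kc_perm, rule kc_perm, rule kc_perm,
          rule a(2)[unfolded computes_def, rule_format, of "O0 y # O0 x # as"])
         (simp_all add: swap_at_def numeral_2_eq_2 numeral_3_eq_3)
  qed
  then show ?thesis by blast
qed

lemma computes_fun: "\<exists>e. \<forall>f x. computes e f x (f x)"
proof -
  have "kc (KPerm 1 (KPerm 0 KApp1)) (O0 x # O2 Suslin_S # O1 f # as) (f x)" for f x as
    by (rule kc_perm, rule kc_perm, rule S7[of f x "O2 Suslin_S # as"]) (simp_all add: swap_at_def)
  then show ?thesis unfolding computes_def by blast
qed

text \<open>S8 runs the inner program with \<open>n\<close> in front of the functional and demands a
  value for every \<open>n\<close>. The swaps expose the functional to S8 and then restore the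
  argument order that \<open>e1\<close> expects.\<close>

lemma computes_Suslin: "\<exists>e. \<forall>f x g. (\<forall>n. computes e1 f (pair n x) (g n)) \<longrightarrow> computes e f x (Suslin_S g)"
proof -
  obtain ep where ep: "\<And>x y as. kc ep (O0 x # O0 y # as) (pair x y)"
    using K2_pair unfolding K2_def by blast
  let ?e = "KPerm 0 (KApp2 (KPerm 1 (KComp (KPerm 2 (KPerm 1 (KPerm 3 (KPerm 2 e1)))) ep)))"
  have "computes ?e f x (Suslin_S g)" if a: "\<forall>n. computes e1 f (pair n x) (g n)" for f x g
    unfolding computes_def
  proof
    fix as
    have "kc (KPerm 1 (KComp (KPerm 2 (KPerm 1 (KPerm 3 (KPerm 2 e1)))) ep))
        (O0 n # O2 Suslin_S # O0 x # O1 f # as) (g n)" for n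
      by (rule kc_perm, rule S4[OF ep], rule kc_perm, rule kc_perm, rule kc_perm, rule kc_perm,
          rule a[unfolded computes_def, rule_format, of n "O0 n # O0 x # as"])
         (simp_all add: swap_at_def numeral_2_eq_2 numeral_3_eq_3)
    then have "kc (KApp2 (KPerm 1 (KComp (KPerm 2 (KPerm 1 (KPerm 3 (KPerm 2 e1)))) ep)))
        (O2 Suslin_S # O0 x # O1 f # as) (Suslin_S g)"
      by (intro S8 allI)
    then show "kc ?e (O0 x # O2 Suslin_S # O1 f # as) (Suslin_S g)"
      by (rule kc_perm) (simp_all add: swap_at_def)
  qed
  then show ?thesis by blast
qed

text \<open>A universal program: the first component of the input is an index, and S9 runs the
  program with that index on the same input.\<close>

lemma computes_self: "\<exists>e. \<forall>E f r v. computes E f (pair (enc E) r) v \<longrightarrow> computes e f (pair (enc E) r) v"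
proof -
  obtain ep where ep: "\<And>x as. kc ep (O0 x # as) (p1 x)"
    using K1_p1 unfolding K1_def by blast
  have "computes (KComp KEnum ep) f (pair (enc E) r) v" if "computes E f (pair (enc E) r) v" for E f r v
    using that unfolding computes_def by (auto intro!: S4[OF ep] S9)
  then show ?thesis by blast
qed

text \<open>Primitive recursion on \<open>b x\<close> serves as a lazy branch. S5 always evaluates
  the base, so \<open>e0\<close> must converge in both cases, whereas \<open>e1\<close> is run only
  if \<open>b x = 1\<close>; at a leaf there are no children to query.\<close>

lemma computes_case:
  assumes "K1 b"
  shows "\<exists>e. \<forall>f x u v. computes e0 f x u \<longrightarrow>
    (b x = 0 \<longrightarrow> computes e f x u) \<and> (b x = 1 \<longrightarrow> computes e1 f x v \<longrightarrow> computes e f x v)"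
proof -
  obtain eb where eb: "\<And>x as. kc eb (O0 x # as) (b x)"
    using assms unfolding K1_def by blast
  let ?s = "KPerm 1 (KPerm 0 (KPerm 2 (KPerm 1 (KPerm 3 (KPerm 2 e1)))))"
  let ?e = "KComp (KPrimRec e0 ?s) eb"
  have 0: "computes ?e f x u" if "computes e0 f x u" "b x = 0" for f x u
    using that eb[of x] unfolding computes_def by (metis S4 S5_0)
  have 1: "computes ?e f x v" if a: "computes e0 f x u" "b x = 1" "computes e1 f x v" for f x u v
    unfolding computes_def
  proof
    fix as
    have "kc ?s (O0 u # O0 0 # O0 x # O2 Suslin_S # O1 f # as) v"
      by (rule kc_perm, rule kc_perm, rule kc_perm, rule kc_perm, rule kc_perm, rule kc_perm,
          rule a(3)[unfolded computes_def, rule_format, of "O0 u # O0 0 # as"])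
         (simp_all add: swap_at_def numeral_2_eq_2 numeral_3_eq_3)
    moreover have "kc (KPrimRec e0 ?s) (O0 0 # O0 x # O2 Suslin_S # O1 f # as) u"
      using a(1) unfolding computes_def by (blast intro: S5_0)
    ultimately have "kc (KPrimRec e0 ?s) (O0 (b x) # O0 x # O2 Suslin_S # O1 f # as) v"
      using S5_Suc a(2) by (metis One_nat_def)
    with eb[of x] show "kc ?e (O0 x # O2 Suslin_S # O1 f # as) v" by (blast intro: S4)
  qed
  from 0 1 show ?thesis by blast
qed

text \<open>The input carries the index of the running program as its first component, and so does every
  recursive query \<open>\<alpha>\<close>; thus \<open>S9\<close> replaces the recursion theorem.\<close>
lemma computes_rec:
  assumes "K1 nd" "K1 b" "K1 leaf" "K1 \<alpha>" "K1 \<beta>"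
  shows "\<exists>E. \<forall>f r w. w = pair (f (nd (pair (enc E) r))) (pair (enc E) r) \<longrightarrow>
    (b w = 0 \<longrightarrow> computes E f (pair (enc E) r) (leaf w)) \<and>
    (\<forall>q h. b w = 1 \<longrightarrow> (\<forall>t. \<alpha> (pair t w) = pair (enc E) (q t)) \<longrightarrow>
        (\<forall>t. computes E f (pair (enc E) (q t)) (h t)) \<longrightarrow>
        computes E f (pair (enc E) r) (Suslin_S (\<lambda>t. \<beta> (pair (h t) (pair t w)))))"
proof -
  obtain en where en: "\<And>f x. computes en f x (nd x)" using computes_K1[OF assms(1)] by blast
  obtain el where el: "\<And>f x. computes el f x (leaf x)" using computes_K1[OF assms(3)] by blast
  obtain ea where ea: "\<And>f x. computes ea f x (\<alpha> x)" using computes_K1[OF assms(4)] by blast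
  obtain eb where eb: "\<And>f x. computes eb f x (\<beta> x)" using computes_K1[OF assms(5)] by blast
  obtain ef where ef: "\<And>f x. computes ef f x (f x)" using computes_fun by blast
  obtain es where es: "\<And>E f r v. computes E f (pair (enc E) r) v \<Longrightarrow> computes es f (pair (enc E) r) v"
    using computes_self by blast
  \<comment> \<open>Assembly: \<open>elab\<close> reads the label, \<open>eq\<close> runs the
    program on a query, \<open>et\<close> tests its answer, \<open>ei\<close> applies the functional
    to all tests, \<open>ec\<close> separates leaves from inner nodes, and \<open>E\<close> puts the
    label in front of the input.\<close>
  obtain elab where elab: "\<And>f x. computes elab f x (f (nd x))"
    using computes_comp[of en ef] en ef by blast
  obtain eq where eq: "\<And>f y E r v. \<alpha> y = pair (enc E) r \<Longrightarrow> computes E f (pair (enc E) r) v \<Longrightarrow> computes eq f y v"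
    using computes_comp[of ea es] ea es by metis
  obtain et where et: "\<And>f y E r v. \<alpha> y = pair (enc E) r \<Longrightarrow> computes E f (pair (enc E) r) v \<Longrightarrow>
      computes et f y (\<beta> (pair v y))"
    using computes_comp_pair[of eq eb] eq eb by metis
  obtain ei where ei: "\<And>f w g. \<forall>t. computes et f (pair t w) (g t) \<Longrightarrow> computes ei f w (Suslin_S g)"
    using computes_Suslin[of et] by blast
  obtain ec where ec0: "\<And>f w. b w = 0 \<Longrightarrow> computes ec f w (leaf w)"
      and ec1: "\<And>f w v. b w = 1 \<Longrightarrow> computes ei f w v \<Longrightarrow> computes ec f w v"
    using computes_case[OF assms(2), of el ei] el by metis
  obtain E where E: "\<And>f x v. computes ec f (pair (f (nd x)) x) v \<Longrightarrow> computes E f x v"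
    using computes_comp_pair[of elab ec] elab by metis
  show ?thesis
  proof (intro exI[of _ E] allI impI conjI)
    fix f r w assume w: "w = pair (f (nd (pair (enc E) r))) (pair (enc E) r)"
    { assume "b w = 0"
      from ec0[OF this] show "computes E f (pair (enc E) r) (leaf w)" unfolding w by (rule E) }
    fix q h
    assume "b w = 1" and a: "\<forall>t. \<alpha> (pair t w) = pair (enc E) (q t)"
        "\<forall>t. computes E f (pair (enc E) (q t)) (h t)"
    have "\<forall>t. computes et f (pair t w) (\<beta> (pair (h t) (pair t w)))"
      using a et by blast
    from ec1[OF \<open>b w = 1\<close> ei[OF this]]
    show "computes E f (pair (enc E) r) (Suslin_S (\<lambda>t. \<beta> (pair (h t) (pair t w))))"
      unfolding w by (rule E)
  qed
qed

section \<open>Clopen sets and approximation in measure\<close>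

definition depends_on :: "nat \<Rightarrow> cantor set \<Rightarrow> bool" where
  "depends_on R X \<longleftrightarrow> (\<forall>x y. (\<forall>i<R. x i = y i) \<longrightarrow> (x \<in> X \<longleftrightarrow> y \<in> X))"

lemma depends_onD: "depends_on R X \<Longrightarrow> (\<And>i. i < R \<Longrightarrow> x i = y i) \<Longrightarrow> x \<in> X \<longleftrightarrow> y \<in> X"
  unfolding depends_on_def by blast

lemma depends_on_mono: "depends_on R X \<Longrightarrow> R \<le> R' \<Longrightarrow> depends_on R' X"
  by (rule depends_on_def[THEN iffD2], intro allI impI, erule depends_onD) (simp add: less_le_trans)

lemma depends_on_Diff: "depends_on R X \<Longrightarrow> depends_on R Y \<Longrightarrow> depends_on R (X - Y)"
  unfolding depends_on_def Diff_iff Un_iff Compl_iff by blast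

lemma depends_on_Un: "depends_on R X \<Longrightarrow> depends_on R Y \<Longrightarrow> depends_on R (X \<union> Y)"
  unfolding depends_on_def Diff_iff Un_iff Compl_iff by blast

lemma depends_on_Compl: "depends_on R X \<Longrightarrow> depends_on R (- X)"
  unfolding depends_on_def Diff_iff Un_iff Compl_iff by blast

lemma bits_eq_bit: "bits w i = bit w i"
  by (simp add: bits_def bit_iff_odd)

lemma ex_bits: "\<exists>w<2 ^ R. \<forall>i<R. bits w i = x i"
proof (intro exI[of _ "horner_sum of_bool 2 (map x [0..<R])"] conjI)
  show "horner_sum of_bool 2 (map x [0..<R]) < (2::nat) ^ R"
    using horner_sum_of_bool_2_less[of "map x [0..<R]"] by simp
  show "\<forall>i<R. bits (horner_sum of_bool 2 (map x [0..<R])) i = x i"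
    by (simp add: bits_eq_bit bit_horner_sum_bit_iff)
qed

lemma bits_inj:
  assumes "w < 2 ^ R" "w' < 2 ^ R" "\<forall>i<R. bits w i = bits w' i"
  shows "w = w'"
proof -
  have "take_bit R w = take_bit R w'"
    using assms(3) by (intro bit_eqI) (auto simp: bit_take_bit_iff bits_eq_bit)
  with assms(1,2) show ?thesis by (simp add: take_bit_nat_eq_self)
qed

definition box :: "nat \<Rightarrow> nat \<Rightarrow> cantor set" where
  "box R w = {x. \<forall>i<R. x i = bits w i}"

lemma depends_on_eq_Union_box:
  assumes "depends_on R X"
  shows "X = (\<Union>w\<in>{w. w < 2 ^ R \<and> bits w \<in> X}. box R w)"
proof (intro set_eqI iffI)
  fix x assume x: "x \<in> X"
  obtain w where w: "w < 2 ^ R" "\<forall>i<R. bits w i = x i" using ex_bits by blast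
  then have "bits w \<in> X" using depends_onD[OF assms, of x "bits w"] x by auto
  with w show "x \<in> (\<Union>w\<in>{w. w < 2 ^ R \<and> bits w \<in> X}. box R w)"
    by (auto simp: box_def)
next
  fix x assume "x \<in> (\<Union>w\<in>{w. w < 2 ^ R \<and> bits w \<in> X}. box R w)"
  then obtain w where "bits w \<in> X" "\<forall>i<R. x i = bits w i" by (auto simp: box_def)
  then show "x \<in> X" using depends_onD[OF assms, of x "bits w"] by simp
qed

text \<open>A code bounds the length of every word that it lists, so the code itself serves as a
  number of relevant coordinates.\<close>

lemma depends_on_clopen_code: "depends_on k (clopen_code k)"
  unfolding depends_on_def
proof (intro allI impI)
  fix x y :: cantor assume eq: "\<forall>i<k. x i = y i"
  have "len_code (nth_code k j) \<le> k" for j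
    using len_code_le[of "nth_code k j"] nth_code_le[of k j] by linarith
  with eq have "x i = y i" if "i < len_code (nth_code k j)" for i j
    using that less_le_trans by blast
  then show "x \<in> clopen_code k \<longleftrightarrow> y \<in> clopen_code k"
    unfolding mem_clopen_code by simp
qed

lemma depends_on_stage_set: "depends_on t (stage_set t)"
proof -
  have "depends_on t (clopen_code (p2 (nth_code t i)))" for i
  proof (rule depends_on_mono[OF depends_on_clopen_code])
    have "p2 (nth_code t i) \<le> nth_code t i"
      using le_prod_encode_2[of "p2 (nth_code t i)" "p1 (nth_code t i)"] by simp
    then show "p2 (nth_code t i) \<le> t" using nth_code_le[of t i] by linarith
  qed
  then have "x \<in> clopen_code (p2 (nth_code t i)) \<longleftrightarrow> y \<in> clopen_code (p2 (nth_code t i))"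
    if "\<forall>i<t. x i = y i" for x y i using that unfolding depends_on_def by blast
  then show ?thesis unfolding depends_on_def stage_set_def mem_Collect_eq
    by (intro allI impI) (simp only:)
qed

lemma ex_clopen_code:
  assumes "depends_on R X" shows "\<exists>k. clopen_code k = X"
proof -
  define S where "S = {w. w < 2 ^ R \<and> bits w \<in> X}"
  have "finite S" unfolding S_def by simp
  then obtain ws where ws: "set ws = S" using finite_list by blast
  define s where "s w = map (\<lambda>i. of_bool (bits w i) :: nat) [0..<R]" for w
  have "cylinder (s w) = box R w" for w by (auto simp: cylinder_def s_def box_def)
  then have "clopen_code (list_encode (map (\<lambda>w. list_encode (s w)) ws)) = (\<Union>w\<in>S. box R w)"
    unfolding clopen_code_def by (simp add: ws)
  also have "\<dots> = X" unfolding S_def using depends_on_eq_Union_box[OF assms] by simp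
  finally show ?thesis by blast
qed

section \<open>The coin-tossing measure and the density of clopen sets\<close>

abbreviation cantor_PiM :: "cantor measure" where
  "cantor_PiM \<equiv> PiM UNIV (\<lambda>_. measure_pmf (bernoulli_pmf (1/2)))"

interpretation coin: product_prob_space "\<lambda>_::nat. measure_pmf (bernoulli_pmf (1/2))" UNIV
  by unfold_locales

interpretation cantor: complete_measure cantor_measure
  unfolding cantor_measure_def by (rule completion.complete_measure_axioms)

lemma prob_space_cantor_measure: "prob_space cantor_measure"
  unfolding cantor_measure_def using coin.prob_space_axioms
  by (rule prob_space.prob_space_completion)

interpretation cantor: prob_space cantor_measure
  by (rule prob_space_cantor_measure)

lemma space_cantor_measure [simp]: "space cantor_measure = UNIV"
  by (simp add: cantor_measure_def space_PiM)

lemma measure_cantor_eq: "A \<in> sets cantor_PiM \<Longrightarrow> measure cantor_measure A = measure cantor_PiM A"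
  unfolding cantor_measure_def by (rule measure_completion)

lemma sets_cantorI: "A \<in> sets cantor_PiM \<Longrightarrow> A \<in> sets cantor_measure"
  unfolding cantor_measure_def by (rule sets_completionI_sets)

lemma box_eq_emb: "box R w = prod_emb UNIV (\<lambda>_. measure_pmf (bernoulli_pmf (1/2))) {..<R}
     (PiE {..<R} (\<lambda>i. {bits w i}))"
  by (intro set_eqI) (simp add: box_def prod_emb_def PiE_iff Ball_def)

lemma sets_box: "box R w \<in> sets cantor_PiM"
  unfolding box_eq_emb by (rule sets_PiM_I) auto

lemma measure_box: "measure cantor_measure (box R w) = 1 / 2 ^ R"
proof -
  have "measure cantor_PiM (box R w) = (\<Prod>i<R. measure (measure_pmf (bernoulli_pmf (1/2))) {bits w i})"
    unfolding box_eq_emb by (rule coin.measure_PiM_emb) auto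
  also have "\<dots> = (\<Prod>i<R. 1 / 2)"
    by (intro prod.cong refl) (simp add: measure_pmf_single pmf_bernoulli_half)
  finally show ?thesis by (simp add: measure_cantor_eq sets_box power_one_over)
qed

lemma sets_depends_on: "depends_on R X \<Longrightarrow> X \<in> sets cantor_PiM"
  by (subst depends_on_eq_Union_box) (auto intro!: sets.finite_UN sets_box)

lemma measure_depends_on:
  assumes "depends_on R X"
  shows "measure cantor_measure X = word_count R X / 2 ^ R"
proof -
  let ?S = "{w. w < 2 ^ R \<and> bits w \<in> X}"
  have "measure cantor_measure X = measure cantor_measure (\<Union>w\<in>?S. box R w)"
    using depends_on_eq_Union_box[OF assms] by simp
  also have "\<dots> = (\<Sum>w\<in>?S. measure cantor_measure (box R w))"
  proof (rule cantor.finite_measure_finite_Union)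
    show "disjoint_family_on (box R) ?S"
      unfolding disjoint_family_on_def box_def using bits_inj[of _ R] by fastforce
  qed (auto intro: sets_cantorI sets_box)
  also have "\<dots> = card ?S / 2 ^ R" by (simp add: measure_box)
  also have "card ?S = word_count R X"
    by (simp add: word_count_def of_bool_def sum.If_cases Int_def)
  finally show ?thesis .
qed

definition clopen_approx :: "cantor set \<Rightarrow> bool" where
  "clopen_approx A \<longleftrightarrow> (\<forall>\<epsilon>>0. \<exists>R X. depends_on R X \<and> measure cantor_measure (sym_diff A X) < \<epsilon>)"

lemma clopen_approx_Compl: "clopen_approx A \<Longrightarrow> clopen_approx (- A)"
  unfolding clopen_approx_def
proof (intro allI impI)
  fix e :: real
  assume "\<forall>\<epsilon>>0. \<exists>R X. depends_on R X \<and> measure cantor_measure (sym_diff A X) < \<epsilon>" "0 < e"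
  then obtain R X where "depends_on R X" "measure cantor_measure (sym_diff A X) < e" by blast
  moreover have "sym_diff (- A) (- X) = sym_diff A X" by auto
  ultimately show "\<exists>R X. depends_on R X \<and> measure cantor_measure (sym_diff (- A) X) < e"
    using depends_on_Compl by metis
qed

lemma clopen_approx_Un:
  assumes "clopen_approx A" "clopen_approx B" "A \<in> sets cantor_measure" "B \<in> sets cantor_measure"
  shows "clopen_approx (A \<union> B)"
  unfolding clopen_approx_def
proof (intro allI impI)
  fix e :: real assume e: "0 < e"
  obtain R X where X: "depends_on R X" "measure cantor_measure (sym_diff A X) < e / 2"
    using assms(1) e unfolding clopen_approx_def by (meson half_gt_zero)
  obtain R' Y where Y: "depends_on R' Y" "measure cantor_measure (sym_diff B Y) < e / 2"
    using assms(2) e unfolding clopen_approx_def by (meson half_gt_zero)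
  have m: "X \<in> sets cantor_measure" "Y \<in> sets cantor_measure"
    using X Y by (auto intro: sets_cantorI sets_depends_on)
  have "measure cantor_measure (sym_diff (A \<union> B) (X \<union> Y)) \<le>
      measure cantor_measure (sym_diff A X \<union> sym_diff B Y)"
    using assms m by (intro cantor.finite_measure_mono) auto
  also have "\<dots> \<le> measure cantor_measure (sym_diff A X) + measure cantor_measure (sym_diff B Y)"
    using assms m by (intro measure_Un_le) auto
  finally have "measure cantor_measure (sym_diff (A \<union> B) (X \<union> Y)) < e" using X Y by linarith
  moreover have "depends_on (max R R') (X \<union> Y)" using X Y by (intro depends_on_Un) (auto intro: depends_on_mono)
  ultimately show "\<exists>R Z. depends_on R Z \<and> measure cantor_measure (sym_diff (A \<union> B) Z) < e" by blast
qed

text \<open>Continuity from below replaces the countable union by a finite one at the cost e/2; the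
  other e/2 pays for approximating the finite union.\<close>

lemma clopen_approx_UN:
  assumes "\<And>n::nat. clopen_approx (A n)" "\<And>n. A n \<in> sets cantor_measure"
  shows "clopen_approx (\<Union>n. A n)"
  unfolding clopen_approx_def
proof (intro allI impI)
  fix e :: real assume e: "0 < e"
  define U where "U n = (\<Union>i\<le>n. A i)" for n
  have U: "U n \<in> sets cantor_measure \<and> clopen_approx (U n)" for n
  proof (induction n)
    case (Suc n)
    have "U (Suc n) = U n \<union> A (Suc n)" by (auto simp: U_def atMost_Suc)
    with Suc assms show ?case by (auto intro: clopen_approx_Un)
  qed (use assms in \<open>auto simp: U_def\<close>)
  have UA: "(\<Union>n. U n) = (\<Union>n. A n)" by (auto simp: U_def)
  have "(\<lambda>n. measure cantor_measure (U n)) \<longlonglongrightarrow> measure cantor_measure (\<Union>n. U n)"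
    using U by (intro cantor.finite_Lim_measure_incseq) (auto simp: incseq_def U_def intro: order_trans)
  then have "\<forall>\<^sub>F n in sequentially. measure cantor_measure (\<Union>n. A n) - e / 2 < measure cantor_measure (U n)"
    unfolding UA using e by (intro order_tendstoD) auto
  then obtain n where n: "measure cantor_measure (\<Union>n. A n) - e / 2 < measure cantor_measure (U n)"
    by (auto simp: eventually_sequentially)
  obtain R X where X: "depends_on R X" "measure cantor_measure (sym_diff (U n) X) < e / 2"
    using U[of n] e unfolding clopen_approx_def by (meson half_gt_zero)
  have m: "X \<in> sets cantor_measure" "(\<Union>n. A n) \<in> sets cantor_measure" "U n \<in> sets cantor_measure"
    using X assms U by (auto intro: sets_cantorI sets_depends_on)
  have sub: "U n \<subseteq> (\<Union>n. A n)" by (auto simp: U_def)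
  have "measure cantor_measure (sym_diff (\<Union>n. A n) X) \<le>
      measure cantor_measure (((\<Union>n. A n) - U n) \<union> sym_diff (U n) X)"
    using m sub by (intro cantor.finite_measure_mono) auto
  also have "\<dots> \<le> measure cantor_measure ((\<Union>n. A n) - U n) + measure cantor_measure (sym_diff (U n) X)"
    using m by (intro measure_Un_le) auto
  also have "measure cantor_measure ((\<Union>n. A n) - U n) = measure cantor_measure (\<Union>n. A n) - measure cantor_measure (U n)"
    using m sub by (intro cantor.finite_measure_Diff) auto
  finally have "measure cantor_measure (sym_diff (\<Union>n. A n) X) < e" using n X by linarith
  with X show "\<exists>R X. depends_on R X \<and> measure cantor_measure (sym_diff (\<Union>n. A n) X) < e" by blast
qed

lemma clopen_approx_depends_on: "depends_on R X \<Longrightarrow> clopen_approx X"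
  unfolding clopen_approx_def by (metis Diff_cancel Un_empty_left measure_empty)

text \<open>Induction over the generated sigma-algebra; the generators restrict a single coordinate
  and are clopen.\<close>

lemma clopen_approx_PiM:
  assumes "A \<in> sets cantor_PiM"
  shows "clopen_approx A"
proof -
  let ?G = "{{f \<in> UNIV. f i \<in> B} |i B. i \<in> UNIV \<and> B \<in> sets (measure_pmf (bernoulli_pmf (1/2)))} :: cantor set set"
  have eq: "sets cantor_PiM = sigma_sets UNIV ?G"
    by (subst sets_PiM_single) (simp add: PiE_UNIV_domain)
  have "A \<in> sigma_sets UNIV ?G" using assms eq by simp
  then show ?thesis
  proof (induction rule: sigma_sets.induct)
    case (Basic a)
    then obtain i B where "a = {f. f i \<in> B}" by auto
    then have "depends_on (Suc i) a" by (auto simp: depends_on_def)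
    then show ?case by (rule clopen_approx_depends_on)
  next
    case Empty
    have "depends_on 0 {}" by (simp add: depends_on_def)
    then show ?case by (rule clopen_approx_depends_on)
  next
    case (Compl a)
    then show ?case using clopen_approx_Compl[of a] by (simp add: Compl_eq_Diff_UNIV)
  next
    case (Union a)
    have "a i \<in> sets cantor_measure" for i
      by (rule sets_cantorI) (use Union eq in blast)
    with Union show ?case by (intro clopen_approx_UN) auto
  qed
qed

text \<open>A set measurable for the completion differs from a product-measurable set by a null set,
  which does not affect the approximation.\<close>

lemma ex_clopen_sym_diff_less:
  assumes "A \<in> sets cantor_measure" "0 < \<epsilon>"
  shows "\<exists>k. measure cantor_measure (sym_diff A (clopen_code k)) < \<epsilon>"
proof -
  have A: "A \<in> sets (completion cantor_PiM)" using assms(1) by (simp add: cantor_measure_def)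
  define B where "B = main_part cantor_PiM A"
  have B: "B \<in> sets cantor_PiM" unfolding B_def using A by (rule main_part_sets)
  define N where "N = null_part cantor_PiM A"
  have N: "A = B \<union> N" "B \<inter> N = {}"
    using main_part_null_part_Un[OF A] main_part_null_part_Int[OF A] by (simp_all add: B_def N_def)
  obtain N' where "N' \<in> null_sets cantor_PiM" "N \<subseteq> N'"
    using null_part[OF A] unfolding N_def by blast
  then have N0: "N \<in> null_sets cantor_measure"
    unfolding cantor_measure_def by (blast intro: null_sets_completionI null_sets_completion_subset)
  obtain R X where X: "depends_on R X" "measure cantor_measure (sym_diff B X) < \<epsilon>"
    using clopen_approx_PiM[OF B] assms(2) unfolding clopen_approx_def by blast
  obtain k where k: "clopen_code k = X" using ex_clopen_code[OF X(1)] by blast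
  have m: "X \<in> sets cantor_measure" "B \<in> sets cantor_measure" "N \<in> sets cantor_measure"
    using X B N0 by (auto intro: sets_cantorI sets_depends_on)
  have "measure cantor_measure (sym_diff A X) \<le> measure cantor_measure (sym_diff B X \<union> N)"
    using m N(1) by (intro cantor.finite_measure_mono) auto
  also have "\<dots> = measure cantor_measure (sym_diff B X)"
    using m N0 by (intro measure_Un_null_set) auto
  finally show ?thesis using X(2) unfolding k[symmetric] by (meson le_less_trans)
qed

section \<open>Suslin schemes with bounded branches\<close>

text \<open>The Suslin operation along branches whose first \<open>n\<close> codes obey
  \<open>H\<close>. For n = 0 this is the full operation; larger \<open>n\<close> impose the bounds
  one level at a time.\<close>

definition bounded_branches :: "(nat \<Rightarrow> nat) \<Rightarrow> nat \<Rightarrow> (nat \<Rightarrow> 'a set) \<Rightarrow> 'a set" where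
  "bounded_branches H n Q = {x. \<exists>f. (\<forall>i<n. fbar f i < H i) \<and> (\<forall>i. x \<in> Q (fbar f i))}"

definition level_set :: "(nat \<Rightarrow> nat) \<Rightarrow> nat \<Rightarrow> (nat \<Rightarrow> 'a set) \<Rightarrow> 'a set" where
  "level_set H n Q = {x. \<exists>s. length s = n \<and>
     (\<forall>i\<le>n. list_encode (take i s) < H i \<and> x \<in> Q (list_encode (take i s)))}"

lemma bounded_branches_Suc_subset_level_set: "bounded_branches H (Suc n) Q \<subseteq> level_set H n Q"
proof
  fix x assume "x \<in> bounded_branches H (Suc n) Q"
  then obtain f where f: "\<forall>i<Suc n. fbar f i < H i" "\<forall>i. x \<in> Q (fbar f i)"
    by (auto simp: bounded_branches_def)
  have "list_encode (take i (map f [0..<n])) = fbar f i" if "i \<le> n" for i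
    using that by (simp add: fbar_def take_map)
  with f show "x \<in> level_set H n Q"
    unfolding level_set_def by (intro CollectI exI[of _ "map f [0..<n]"]) auto
qed

lemma level_set_antimono: "n \<le> m \<Longrightarrow> level_set H m Q \<subseteq> level_set H n Q"
proof
  fix x assume "n \<le> m" "x \<in> level_set H m Q"
  then obtain s where s: "length s = m" "\<forall>i\<le>m. list_encode (take i s) < H i \<and> x \<in> Q (list_encode (take i s))"
    by (auto simp: level_set_def)
  have "take i (take n s) = take i s" if "i \<le> n" for i using that by (simp add: min_absorb1)
  with s \<open>n \<le> m\<close> show "x \<in> level_set H n Q"
    unfolding level_set_def by (intro CollectI exI[of _ "take n s"]) auto
qed

text \<open>Koenig's lemma: the bounds \<open>H\<close> make the tree of sequences that keep
  \<open>x\<close> finitely branching, so nodes at all levels yield an infinite branch.\<close>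

lemma mem_all_levels:
  assumes "\<And>n. x \<in> level_set H n Q"
  shows "\<exists>f. \<forall>i. x \<in> Q (fbar f i)"
proof -
  define T where "T n s \<longleftrightarrow> length s = n \<and>
     (\<forall>i\<le>n. list_encode (take i s) < H i \<and> x \<in> Q (list_encode (take i s)))" for n s
  \<comment> \<open>A good node has extensions in the tree at every greater level; a branch is built
    out of good nodes.\<close>
  define good where "good s \<longleftrightarrow> (\<forall>m\<ge>length s. \<exists>s'. T m s' \<and> take (length s) s' = s)" for s
  have T_take: "T n (take n s)" if "T m s" "n \<le> m" for n m s
  proof -
    have "take i (take n s) = take i s" if "i \<le> n" for i using that by (simp add: min_absorb1)
    with that show ?thesis by (simp add: T_def)
  qed
  have good0: "good []"
    using assms by (auto simp: good_def level_set_def T_def)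
  have step: "\<exists>a. good (s @ [a])" if "good s" for s
  proof (rule ccontr)
    assume "\<nexists>a. good (s @ [a])"
    then have "\<forall>a. \<exists>m\<ge>Suc (length s). \<nexists>s'. T m s' \<and> take (Suc (length s)) s' = s @ [a]"
      by (auto simp: good_def)
    then obtain m where m: "\<And>a. m a \<ge> Suc (length s)"
        "\<And>a s'. T (m a) s' \<Longrightarrow> take (Suc (length s)) s' \<noteq> s @ [a]" by metis
    let ?S = "{a. list_encode (s @ [a]) < H (Suc (length s))}"
    have "finite ?S"
      by (rule finite_vimageI[of "{..<H (Suc (length s))}" "\<lambda>a. list_encode (s @ [a])",
            unfolded vimage_def lessThan_iff])
         (auto simp: inj_on_def list_encode_eq)
    \<comment> \<open>Level \<open>k\<close> lies beyond every level \<open>m a\<close> at which an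
      admissible child of \<open>s\<close> fails. An extension of \<open>s\<close> to level
      \<open>k\<close> passes through one of these finitely many children, a contradiction.\<close>
    define k where "k = Suc (length s) + (\<Sum>a\<in>?S. m a)"
    have "length s \<le> k" by (simp add: k_def)
    then obtain s' where s': "T k s'" "take (length s) s' = s"
      using \<open>good s\<close> unfolding good_def by blast
    have len: "length s' = k" "length s < k" using s' by (auto simp: T_def k_def)
    define a where "a = s' ! length s"
    have tk: "take (Suc (length s)) s' = s @ [a]"
      using len s'(2) by (simp add: take_Suc_conv_app_nth a_def)
    have "a \<in> ?S" using s'(1) len tk unfolding T_def by (metis Suc_leI mem_Collect_eq)
    then have "m a \<le> k" unfolding k_def using member_le_sum[of a ?S m] \<open>finite ?S\<close> by simp
    from T_take[OF s'(1) this] m(2)[of a "take (m a) s'"] m(1)[of a] tk show False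
      by (simp add: min_absorb1)
  qed
  obtain F where F: "\<And>n. good (F n) \<and> length (F n) = n" "\<And>n. \<exists>a. F (Suc n) = F n @ [a]"
    using dependent_nat_choice[of "\<lambda>n s. good s \<and> length s = n" "\<lambda>n s s'. \<exists>a. s' = s @ [a]"]
      good0 step by (metis length_append_singleton list.size(3))
  define f where "f n = F (Suc n) ! n" for n
  have F_eq: "F n = map f [0..<n]" for n
  proof (induction n)
    case (Suc n)
    obtain a where "F (Suc n) = F n @ [a]" using F(2) by blast
    moreover have "length (F n) = n" using F(1) by blast
    ultimately show ?case using Suc by (simp add: f_def nth_append)
  qed (use F(1)[of 0] in simp)
  have "x \<in> Q (fbar f i)" for i
  proof -
    have "good (F i)" "length (F i) = i" using F(1) by auto
    then obtain s' where "T i s'" "take (length (F i)) s' = F i"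
      unfolding good_def by (metis order_refl)
    then have "x \<in> Q (list_encode (F i))" using F(1)[of i] by (auto simp: T_def)
    then show ?thesis by (simp add: F_eq fbar_def)
  qed
  then show ?thesis by blast
qed

lemma suslinA_eq_bounded_branches: "suslinA P = bounded_branches H 0 (\<lambda>n. P (list_decode n))"
  by (auto simp: suslinA_def bounded_branches_def fbar_def)

lemma sets_level_set:
  assumes "\<And>n. Q n \<in> sets M"
  shows "level_set H n Q \<in> sets M"
proof -
  have "level_set H n Q = (\<Union>s\<in>{s. length s = n \<and> (\<forall>i\<le>n. list_encode (take i s) < H i)}.
      \<Inter>i\<in>{..n}. Q (list_encode (take i s)))"
    by (auto simp: level_set_def)
  also have "\<dots> \<in> sets M"
    using assms by (intro sets.countable_UN' sets.finite_INT) auto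
  finally show ?thesis .
qed

lemma bounded_branches_cong: "(\<And>i. i < n \<Longrightarrow> H i = H' i) \<Longrightarrow> bounded_branches H n Q = bounded_branches H' n Q"
  by (auto simp: bounded_branches_def)

text \<open>As the next bound grows, the restricted sets increase to the unrestricted one. Outer
  measure is continuous along increasing sequences of arbitrary sets, so each bound can be chosen
  without knowing that these sets are measurable.\<close>

lemma ex_bounded_branches_outer_measure:
  assumes "r < outer_measure_of M (C \<inter> bounded_branches H0 0 Q)" "C \<subseteq> space M"
  shows "\<exists>H. \<forall>n. r < outer_measure_of M (C \<inter> bounded_branches H n Q)"
proof -
  have step: "\<exists>m. r < outer_measure_of M (C \<inter> bounded_branches (H(n := m)) (Suc n) Q)"
    if "r < outer_measure_of M (C \<inter> bounded_branches H n Q)" for H n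
  proof -
    let ?R = "\<lambda>m. C \<inter> bounded_branches (H(n := m)) (Suc n) Q"
    have "(\<Union>m. bounded_branches (H(n := m)) (Suc n) Q) = bounded_branches H n Q"
    proof (intro set_eqI iffI)
      fix x assume "x \<in> bounded_branches H n Q"
      then obtain f where f: "\<forall>i<n. fbar f i < H i" "\<forall>i. x \<in> Q (fbar f i)"
        unfolding bounded_branches_def by blast
      then have "x \<in> bounded_branches (H(n := Suc (fbar f n))) (Suc n) Q"
        unfolding bounded_branches_def by (intro CollectI exI[of _ f]) (auto simp: less_Suc_eq)
      then show "x \<in> (\<Union>m. bounded_branches (H(n := m)) (Suc n) Q)" by blast
    next
      fix x assume "x \<in> (\<Union>m. bounded_branches (H(n := m)) (Suc n) Q)"
      then obtain m f where f: "\<forall>i<Suc n. fbar f i < (H(n := m)) i" "\<forall>i. x \<in> Q (fbar f i)"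
        unfolding bounded_branches_def by blast
      have "\<forall>i<n. fbar f i < H i"
      proof (intro allI impI)
        fix i assume "i < n"
        then show "fbar f i < H i" using f(1)[rule_format, of i] by simp
      qed
      with f(2) show "x \<in> bounded_branches H n Q" unfolding bounded_branches_def by blast
    qed
    then have "(\<Union>m. ?R m) = C \<inter> bounded_branches H n Q" by blast
    moreover have "incseq ?R"
    proof (intro monoI Int_mono order_refl)
      fix m m' :: nat assume "m \<le> m'"
      then have "(H(n := m)) i \<le> (H(n := m')) i" for i by simp
      then show "bounded_branches (H(n := m)) (Suc n) Q \<subseteq> bounded_branches (H(n := m')) (Suc n) Q"
        unfolding bounded_branches_def using less_le_trans by blast
    qed
    ultimately have "(SUP m. outer_measure_of M (?R m)) = outer_measure_of M (C \<inter> bounded_branches H n Q)"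
      using assms(2) by (subst SUP_outer_measure_of_incseq) auto
    with that have "r < (SUP m. outer_measure_of M (?R m))" by (simp only:)
    then show ?thesis unfolding less_SUP_iff by blast
  qed
  obtain G where G: "\<And>n. r < outer_measure_of M (C \<inter> bounded_branches (G n) n Q)"
      "\<And>n. \<exists>m. G (Suc n) = (G n)(n := m)"
    using dependent_nat_choice[of "\<lambda>n H. r < outer_measure_of M (C \<inter> bounded_branches H n Q)"
       "\<lambda>n H H'. \<exists>m. H' = H(n := m)"] assms(1) step by metis
  define H where "H n = G (Suc n) n" for n
  have G_H: "i < n \<Longrightarrow> G n i = H i" for i n
  proof (induction n)
    case (Suc n)
    obtain m where m: "G (Suc n) = (G n)(n := m)" using G(2) by blast
    show ?case
    proof (cases "i = n")
      case False
      then have "G (Suc n) i = G n i" using m by simp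
      with False Suc show ?thesis by simp
    qed (simp add: H_def)
  qed simp
  have "bounded_branches (G n) n Q = bounded_branches H n Q" for n by (rule bounded_branches_cong) (rule G_H)
  with G(1) show ?thesis by auto
qed

text \<open>The Suslin operation preserves measurability: inside the set there are measurable sets
  of measure arbitrarily close to that of a measurable hull \<open>E\<close>.\<close>

lemma sets_bounded_branches:
  assumes "finite_measure M" "complete_measure M" "space M = UNIV" "\<And>n. Q n \<in> sets M"
  shows "bounded_branches H0 0 Q \<in> sets M"
proof -
  interpret finite_measure M by fact
  interpret complete_measure M by fact
  let ?A = "bounded_branches H0 0 Q"
  obtain E where E: "E \<in> sets M" "?A \<subseteq> E" "outer_measure_of M ?A = emeasure M E"
    using outer_measure_of_attain[of ?A M] assms(3) by auto
  \<comment> \<open>The inner set is the intersection of all levels for suitable bounds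
    \<open>H\<close>, contained in \<open>?A\<close> by Koenig's lemma. If the target measure is
    negative, where \<open>ennreal\<close> would truncate, the empty set serves.\<close>
  have inner: "\<exists>T\<in>fmeasurable M. T \<subseteq> ?A \<and> measure M E - e \<le> measure M T" if "0 < e" for e
  proof (cases "measure M E - e < 0")
    case False
    have "ennreal (measure M E - e) < ennreal (measure M E)"
      using False that by (intro ennreal_lessI) auto
    then have "ennreal (measure M E - e) < outer_measure_of M (UNIV \<inter> ?A)"
      by (simp add: E emeasure_eq_measure)
    from ex_bounded_branches_outer_measure[OF this]
    obtain H where H: "\<And>n. ennreal (measure M E - e) < outer_measure_of M (bounded_branches H n Q)"
      using assms(3) by auto
    have le: "measure M E - e \<le> measure M (level_set H n Q)" for n
    proof -
      have "ennreal (measure M E - e) \<le> outer_measure_of M (bounded_branches H (Suc n) Q)"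
        using H by (simp add: less_imp_le)
      also have "\<dots> \<le> outer_measure_of M (level_set H n Q)"
        by (intro outer_measure_of_mono bounded_branches_Suc_subset_level_set)
      also have "\<dots> = ennreal (measure M (level_set H n Q))"
        using sets_level_set[of Q M H n] assms(4) by (simp add: emeasure_eq_measure)
      finally show ?thesis by (simp add: ennreal_le_iff)
    qed
    have lim: "(\<lambda>n. measure M (level_set H n Q)) \<longlonglongrightarrow> measure M (\<Inter>n. level_set H n Q)"
      using sets_level_set[of Q M H] assms(4)
      by (intro finite_Lim_measure_decseq antimonoI level_set_antimono) auto
    have "measure M E - e \<le> measure M (\<Inter>n. level_set H n Q)"
      by (rule LIMSEQ_le_const[OF lim]) (use le in blast)
    moreover have "(\<Inter>n. level_set H n Q) \<subseteq> ?A"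
    proof
      fix x assume "x \<in> (\<Inter>n. level_set H n Q)"
      then obtain f where "\<forall>i. x \<in> Q (fbar f i)" using mem_all_levels[of x H Q] by blast
      then show "x \<in> ?A" by (auto simp: bounded_branches_def)
    qed
    moreover have "(\<Inter>n. level_set H n Q) \<in> sets M"
      using sets_level_set[of Q M H] assms(4) by (intro sets.countable_INT) auto
    ultimately show ?thesis by (auto simp: fmeasurable_eq_sets)
  qed (auto intro!: bexI[of _ "{}"])
  have "\<forall>e>0. \<exists>U\<in>fmeasurable M. ?A \<subseteq> U \<and> measure M U \<le> measure M E + e"
    using E by (intro allI impI bexI[of _ E]) (auto simp: fmeasurable_eq_sets)
  with inner show ?thesis
    using fmeasurable_measure_inner_outer_le(1)[of ?A "measure M E"] by (auto simp: fmeasurable_eq_sets)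
qed

section \<open>The measure of a Suslin set\<close>

lemma len_code_fbar [simp]: "len_code (fbar g n) = n"
  by (simp add: len_code_def fbar_def)

lemma nth_code_fbar: "i < n \<Longrightarrow> nth_code (fbar g n) i = g i"
  by (simp add: nth_code_def len_code_def fbar_def)

text \<open>This justifies searching for prefixes \<open>v\<close> of \<open>u\<close> only among v
  < Suc u in \<open>stage_set\<close>.\<close>

lemma list_encode_take_le: "list_encode (take i s) \<le> list_encode s"
proof (induction s arbitrary: i)
  case (Cons a s)
  have mono: "b \<le> c \<Longrightarrow> pair a b \<le> pair a c" for b c
    unfolding prod_encode_def by (auto intro!: add_mono triangle_mono)
  show ?case by (cases i) (simp_all add: mono Cons.IH)
qed simp

lemma prefix_code_list_encode:
  "prefix_code v (list_encode s) \<longleftrightarrow> len_code v \<le> length s \<and> v = list_encode (take (len_code v) s)"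
proof -
  have "(\<forall>j<len_code v. nth_code v j = nth_code (list_encode s) j) \<longleftrightarrow> list_decode v = take (len_code v) s"
    if "len_code v \<le> length s"
    using that by (auto simp: list_eq_iff_nth_eq nth_code_def len_code_def)
  moreover have "list_decode v = xs \<longleftrightarrow> v = list_encode xs" for xs
    by (metis list_decode_inverse list_encode_inverse)
  ultimately show ?thesis by (auto simp: prefix_code_def len_code_def)
qed

definition cut_scheme :: "nat \<Rightarrow> (nat \<Rightarrow> 'a set) \<Rightarrow> nat \<Rightarrow> 'a set" where
  "cut_scheme n D v = (if v < n then D v else UNIV)"

lemma level_set_mono: "(\<And>v. Q v \<subseteq> Q' v) \<Longrightarrow> level_set H n Q \<subseteq> level_set H n Q'"
  unfolding level_set_def by blast

text \<open>A segment of length n + 2 contains the exponent and the pairs for 0, ..., n: all bounds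
  up to level \<open>n\<close>, and the clopen sets with index below n + 1.\<close>

lemma stage_set_eq_level_set:
  "stage_set (fbar g (Suc (Suc n))) =
    level_set (\<lambda>i. p1 (g (Suc i))) n (cut_scheme (Suc n) (\<lambda>v. clopen_code (p2 (g (Suc v)))))"
    (is "stage_set ?t = level_set ?H n ?D")
proof (intro set_eqI iffI)
  fix x assume "x \<in> stage_set ?t"
  then obtain u where u: "len_code u = n"
     "\<And>v. v < Suc u \<Longrightarrow> prefix_code v u \<Longrightarrow> v < p1 (nth_code ?t (Suc (len_code v))) \<and>
        (Suc v < len_code ?t \<longrightarrow> x \<in> clopen_code (p2 (nth_code ?t (Suc v))))"
    by (auto simp: stage_set_def)
  define s where "s = list_decode u"
  have s: "length s = n" "u = list_encode s" using u(1) by (simp_all add: s_def len_code_def)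
  have "list_encode (take i s) < ?H i \<and> x \<in> ?D (list_encode (take i s))" if "i \<le> n" for i
  proof -
    let ?v = "list_encode (take i s)"
    have len: "len_code ?v = i" using that s by (simp add: len_code_def)
    have "?v < Suc u" using list_encode_take_le[of i s] s by simp
    moreover have "prefix_code ?v u" using that s len by (simp add: prefix_code_list_encode)
    ultimately show ?thesis
      using u(2)[of ?v] len that by (auto simp: nth_code_fbar cut_scheme_def)
  qed
  with s show "x \<in> level_set ?H n ?D" by (auto simp: level_set_def)
next
  fix x assume "x \<in> level_set ?H n ?D"
  then obtain s where s: "length s = n"
    "\<And>i. i \<le> n \<Longrightarrow> list_encode (take i s) < ?H i \<and> x \<in> ?D (list_encode (take i s))"
    by (auto simp: level_set_def)
  let ?u = "list_encode s"
  \<comment> \<open>The search bound u < t loses nothing: the code of \<open>s\<close> is below the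
    bound for level \<open>n\<close>, which is itself coded inside \<open>?t\<close>.\<close>
  have "p1 (g (Suc n)) \<le> g (Suc n)"
    using le_prod_encode_1[of "p1 (g (Suc n))" "p2 (g (Suc n))"] by simp
  moreover have "g (Suc n) \<le> ?t" using nth_code_le[of ?t "Suc n"] by (simp add: nth_code_fbar)
  ultimately have "?u < ?t" using s(2)[of n] s(1) by simp
  moreover have "v < p1 (nth_code ?t (Suc (len_code v))) \<and>
        (Suc v < len_code ?t \<longrightarrow> x \<in> clopen_code (p2 (nth_code ?t (Suc v))))" if "prefix_code v ?u" for v
    using that s(1) s(2)[of "len_code v"] by (auto simp: prefix_code_list_encode nth_code_fbar cut_scheme_def)
  ultimately show "x \<in> stage_set ?t"
    using s(1) len_code_fbar[of g "Suc (Suc n)"] unfolding stage_set_def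
    by (intro CollectI exI[of _ ?u]) (simp add: len_code_def)
qed

lemma stage_decreasing:
  "level_set H (Suc n) (cut_scheme (Suc (Suc n)) D) \<subseteq> level_set H n (cut_scheme (Suc n) D)"
proof -
  have "level_set H (Suc n) (cut_scheme (Suc (Suc n)) D) \<subseteq> level_set H n (cut_scheme (Suc (Suc n)) D)"
    by (rule level_set_antimono) simp
  also have "\<dots> \<subseteq> level_set H n (cut_scheme (Suc n) D)"
    by (rule level_set_mono) (auto simp: cut_scheme_def)
  finally show ?thesis .
qed

text \<open>The bounds leave only finitely many codes up to level \<open>n\<close>; at a late stage
  \<open>N\<close> all of them are specified, so the cut scheme agrees with \<open>D\<close> there
  and Koenig's lemma applies.\<close>

lemma mem_all_stages:
  assumes "\<And>n. x \<in> level_set H n (cut_scheme (Suc n) D)"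
  shows "\<exists>f. \<forall>i. x \<in> D (fbar f i)"
proof (rule mem_all_levels)
  fix n
  define N where "N = n + (\<Sum>i\<le>n. H i)"
  have le: "H i \<le> N" if "i \<le> n" for i
    unfolding N_def using that member_le_sum[of i "{..n}" H] by simp
  have "x \<in> level_set H n (cut_scheme (Suc N) D)"
    using assms[of N] level_set_antimono[of n N H "cut_scheme (Suc N) D"] by (auto simp: N_def)
  then obtain s where s: "length s = n" "\<And>i. i \<le> n \<Longrightarrow> list_encode (take i s) < H i"
      "\<And>i. i \<le> n \<Longrightarrow> x \<in> cut_scheme (Suc N) D (list_encode (take i s))"
    unfolding level_set_def by blast
  have "x \<in> D (list_encode (take i s))" if "i \<le> n" for i
    using s(2)[OF that] s(3)[OF that] le[OF that] by (simp add: cut_scheme_def split: if_splits)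
  with s show "x \<in> level_set H n D" unfolding level_set_def by blast
qed

lemma sets_clopen_code: "clopen_code k \<in> sets cantor_measure"
  by (rule sets_cantorI, rule sets_depends_on, rule depends_on_clopen_code)

text \<open>The offset 2 makes the total error 2^-(j+1), strictly less than the margin 2^-j.\<close>

lemma sums_errors: "(\<lambda>n. 1 / 2 ^ (j + n + 2)) sums (1 / 2 ^ Suc j :: real)"
proof -
  have "(\<lambda>n. (1/2) ^ Suc n * (1 / 2 ^ Suc j)) sums (1 * (1 / 2 ^ Suc j) :: real)"
    by (rule sums_mult2) (rule power_half_series)
  then show ?thesis by (simp add: power_add power_one_over field_simps)
qed

lemma measure_UN_errors:
  assumes "\<And>n. X n \<in> sets cantor_measure" "\<And>n. measure cantor_measure (X n) < 1 / 2 ^ (j + n + 2)"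
  shows "measure cantor_measure (\<Union>n. X n) \<le> 1 / 2 ^ Suc j"
proof -
  have s: "summable (\<lambda>n. measure cantor_measure (X n))"
    by (rule summable_comparison_test'[OF sums_summable[OF sums_errors[of j]], of 0])
       (use assms(2) in \<open>auto simp: less_imp_le\<close>)
  have "measure cantor_measure (\<Union>n. X n) \<le> (\<Sum>n. measure cantor_measure (X n))"
    using assms(1) s by (intro cantor.finite_measure_subadditive_countably) auto
  also have "\<dots> \<le> (\<Sum>n. 1 / 2 ^ (j + n + 2))"
    by (intro suminf_le s sums_summable[OF sums_errors]) (use assms(2) in \<open>auto simp: less_imp_le\<close>)
  also have "\<dots> = 1 / 2 ^ Suc j" using sums_errors[of j] by (simp add: sums_iff)
  finally show ?thesis .
qed

text \<open>All data are packed into one function: \<open>g 0\<close> is the exponent and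
  \<open>g (Suc n)\<close> pairs a bound with a clopen code. The conditions then concern finite
  segments of \<open>g\<close> only, as one application of the functional requires.\<close>

lemma measure_minus_bounded_branches_less_iff:
  assumes Q: "\<And>n. Q n \<in> sets cantor_measure"
  shows "measure cantor_measure (clopen_code c - bounded_branches H0 0 Q) < \<delta> \<longleftrightarrow>
    (\<exists>g. \<forall>n. measure cantor_measure (clopen_code (p2 (g (Suc n))) - Q n) < 1 / 2 ^ (g 0 + n + 2) \<and>
      measure cantor_measure (clopen_code c - stage_set (fbar g (Suc (Suc n)))) + 1 / 2 ^ g 0 < \<delta>)"
    (is "?m (?C - ?A) < \<delta> \<longleftrightarrow> ?rhs")
proof
  have A: "?A \<in> sets cantor_measure"
    using Q by (intro sets_bounded_branches cantor.complete_measure_axioms cantor.finite_measure_axioms) auto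
  have C: "?C \<in> sets cantor_measure" by (rule sets_clopen_code)
  {
    assume ?rhs
    then obtain g where g: "\<And>n. ?m (clopen_code (p2 (g (Suc n))) - Q n) < 1 / 2 ^ (g 0 + n + 2)"
      "\<And>n. ?m (?C - stage_set (fbar g (Suc (Suc n)))) + 1 / 2 ^ g 0 < \<delta>" by blast
    define H where "H i = p1 (g (Suc i))" for i
    define D where "D v = clopen_code (p2 (g (Suc v)))" for v
    define E where "E n = level_set H n (cut_scheme (Suc n) D)" for n
    have E: "stage_set (fbar g (Suc (Suc n))) = E n" for n
      unfolding stage_set_eq_level_set E_def H_def D_def ..
    have D: "D n \<in> sets cantor_measure" for n unfolding D_def by (rule sets_clopen_code)
    have Es: "E n \<in> sets cantor_measure" for n
      unfolding E[symmetric] by (rule sets_cantorI, rule sets_depends_on, rule depends_on_stage_set)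
    \<comment> \<open>A point that survives all stages has a branch through \<open>D\<close>; unless
      it lies in some \<open>D n - Q n\<close>, this is also a branch through
      \<open>Q\<close>.\<close>
    have sub: "?C - ?A \<subseteq> (\<Union>n. ?C - E n) \<union> (\<Union>n. D n - Q n)"
    proof
      fix x assume x: "x \<in> ?C - ?A"
      show "x \<in> (\<Union>n. ?C - E n) \<union> (\<Union>n. D n - Q n)"
      proof (rule ccontr)
        assume neg: "x \<notin> (\<Union>n. ?C - E n) \<union> (\<Union>n. D n - Q n)"
        then have "x \<in> level_set H n (cut_scheme (Suc n) D)" for n using x unfolding E_def by blast
        from mem_all_stages[OF this] obtain f where f: "\<And>i. x \<in> D (fbar f i)" by blast
        have "x \<in> Q (fbar f i)" for i using f[of i] neg by blast
        then have "x \<in> ?A" unfolding bounded_branches_def by blast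
        with x show False by blast
      qed
    qed
    have "(\<lambda>n. ?m (?C - E n)) \<longlonglongrightarrow> ?m (\<Union>n. ?C - E n)"
    proof (rule cantor.finite_Lim_measure_incseq)
      show "incseq (\<lambda>n. ?C - E n)"
        using stage_decreasing[of H _ D] by (intro incseq_SucI) (auto simp: E_def)
    qed (use C Es in auto)
    then have 1: "?m (\<Union>n. ?C - E n) \<le> \<delta> - 1 / 2 ^ g 0"
      by (rule LIMSEQ_le_const2) (use g(2) in \<open>auto simp: E less_imp_le le_diff_eq\<close>)
    have 2: "?m (\<Union>n. D n - Q n) \<le> 1 / 2 ^ Suc (g 0)"
      using g(1) D Q by (intro measure_UN_errors) (auto simp: D_def)
    have "?m (?C - ?A) \<le> ?m ((\<Union>n. ?C - E n) \<union> (\<Union>n. D n - Q n))"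
      using sub C Es D Q by (intro cantor.finite_measure_mono) auto
    also have "\<dots> \<le> ?m (\<Union>n. ?C - E n) + ?m (\<Union>n. D n - Q n)"
      using C Es D Q by (intro measure_Un_le) auto
    also have "\<dots> \<le> \<delta> - 1 / 2 ^ g 0 + 1 / 2 ^ Suc (g 0)" using 1 2 by linarith
    also have "\<dots> < \<delta>" by (simp add: field_simps)
    finally show "?m (?C - ?A) < \<delta>" .
  next
    assume "?m (?C - ?A) < \<delta>"
    \<comment> \<open>The slack is twice 2^-j: one part for the measure lost in the stages, the
      other for the margin in the condition to be proved.\<close>
    then obtain j where "(1/2) ^ j < (\<delta> - ?m (?C - ?A)) / 2"
      using real_arch_pow_inv[of "(\<delta> - ?m (?C - ?A)) / 2" "1/2"] by auto
    then have j: "?m (?C - ?A) + 2 / 2 ^ j < \<delta>" by (simp add: power_one_over field_simps)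
    have "\<exists>k. ?m (sym_diff (Q n) (clopen_code k)) < 1 / 2 ^ (j + n + 2)" for n
      by (rule ex_clopen_sym_diff_less[OF Q]) simp
    then obtain d where d: "\<And>n. ?m (sym_diff (Q n) (clopen_code (d n))) < 1 / 2 ^ (j + n + 2)"
      by metis
    define D where "D v = clopen_code (d v)" for v
    have D: "D n \<in> sets cantor_measure" for n unfolding D_def by (rule sets_clopen_code)
    have d1: "?m (D n - Q n) < 1 / 2 ^ (j + n + 2)" for n
    proof -
      have "?m (D n - Q n) \<le> ?m (sym_diff (Q n) (D n))"
        using D Q by (intro cantor.finite_measure_mono) auto
      with d[of n] show ?thesis by (simp add: D_def)
    qed
    have d2: "?m (Q n - D n) < 1 / 2 ^ (j + n + 2)" for n
    proof -
      have "?m (Q n - D n) \<le> ?m (sym_diff (Q n) (D n))"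
        using D Q by (intro cantor.finite_measure_mono) auto
      with d[of n] show ?thesis by (simp add: D_def)
    qed
    \<comment> \<open>The points lost in replacing \<open>Q\<close> by \<open>D\<close>.\<close>
    let ?N = "\<Union>n. Q n - D n"
    have N: "?N \<in> sets cantor_measure" "?m ?N \<le> 1 / 2 ^ Suc j"
      using d2 D Q by (blast, intro measure_UN_errors) auto
    have Es: "level_set H n (cut_scheme (Suc n) D) \<in> sets cantor_measure" for H n
      using sets.top[of cantor_measure] by (intro sets_level_set) (simp add: cut_scheme_def D)
    \<comment> \<open>Half of the loss 2^-j comes from bounding the branches, the other half from
      \<open>?N\<close>. If the target of the first half is negative, any \<open>H\<close>
      works.\<close>
    have "\<exists>H. \<forall>n. ?m (?C \<inter> ?A) - 1 / 2 ^ j \<le> ?m (?C \<inter> level_set H n (cut_scheme (Suc n) D))"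
    proof (cases "?m (?C \<inter> ?A) - 1 / 2 ^ Suc j < 0")
      case True
      moreover have "1 / 2 ^ Suc j \<le> (1 / 2 ^ j :: real)" by (simp add: field_simps)
      ultimately have "?m (?C \<inter> ?A) - 1 / 2 ^ j \<le> 0" by (simp only:)
      then show ?thesis by (meson measure_nonneg order_trans)
    next
      case False
      then have "ennreal (?m (?C \<inter> ?A) - 1 / 2 ^ Suc j) < ennreal (?m (?C \<inter> ?A))"
        by (intro ennreal_lessI) (auto intro: less_le_trans[of 0 "1 / 2 ^ Suc j"])
      then have "ennreal (?m (?C \<inter> ?A) - 1 / 2 ^ Suc j) < outer_measure_of cantor_measure (?C \<inter> ?A)"
        using A C by (simp add: cantor.emeasure_eq_measure)
      from ex_bounded_branches_outer_measure[OF this] obtain H where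
        H: "\<And>n. ennreal (?m (?C \<inter> ?A) - 1 / 2 ^ Suc j) < outer_measure_of cantor_measure (?C \<inter> bounded_branches H n Q)"
        by auto
      have "?m (?C \<inter> ?A) - 1 / 2 ^ j \<le> ?m (?C \<inter> level_set H n (cut_scheme (Suc n) D))" for n
      proof -
        let ?E = "level_set H n (cut_scheme (Suc n) D)"
        have sub: "?C \<inter> bounded_branches H (Suc n) Q \<subseteq> (?C \<inter> ?E) \<union> ?N"
        proof
          fix x assume x: "x \<in> ?C \<inter> bounded_branches H (Suc n) Q"
          show "x \<in> (?C \<inter> ?E) \<union> ?N"
          proof (cases "x \<in> ?N")
            case False
            have "x \<in> level_set H n Q" using x bounded_branches_Suc_subset_level_set[of H n Q] by blast
            then have "x \<in> ?E" using False unfolding level_set_def cut_scheme_def by auto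
            with x show ?thesis by blast
          qed blast
        qed
        have "ennreal (?m (?C \<inter> ?A) - 1 / 2 ^ Suc j) \<le> outer_measure_of cantor_measure ((?C \<inter> ?E) \<union> ?N)"
          using H[of "Suc n"] outer_measure_of_mono[OF sub] by (meson less_imp_le order_trans)
        also have "\<dots> = ennreal (?m ((?C \<inter> ?E) \<union> ?N))"
          using C Es N by (simp add: cantor.emeasure_eq_measure)
        finally have "?m (?C \<inter> ?A) - 1 / 2 ^ Suc j \<le> ?m ((?C \<inter> ?E) \<union> ?N)"
          by (simp add: ennreal_le_iff)
        also have "\<dots> \<le> ?m (?C \<inter> ?E) + ?m ?N"
          using C Es N by (intro measure_Un_le) auto
        finally have "?m (?C \<inter> ?A) \<le> ?m (?C \<inter> ?E) + 1 / 2 ^ Suc j + 1 / 2 ^ Suc j" using N(2) by linarith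
        then show ?thesis by (simp add: field_simps)
      qed
      then show ?thesis by blast
    qed
    then obtain H where H: "\<And>n. ?m (?C \<inter> ?A) - 1 / 2 ^ j \<le> ?m (?C \<inter> level_set H n (cut_scheme (Suc n) D))"
      by blast
    define g where "g i = (case i of 0 \<Rightarrow> j | Suc n \<Rightarrow> pair (H n) (d n))" for i
    have g: "g 0 = j" "p1 (g (Suc n)) = H n" "p2 (g (Suc n)) = d n" for n
      by (simp_all add: g_def)
    have "?m (?C - level_set H n (cut_scheme (Suc n) D)) + 1 / 2 ^ j < \<delta>" for n
    proof -
      let ?E = "level_set H n (cut_scheme (Suc n) D)"
      have "?m (?C - ?E) = ?m ?C - ?m (?C \<inter> ?E)"
        using cantor.finite_measure_Diff'[of ?C ?E] C Es by simp
      moreover have "?m (?C - ?A) = ?m ?C - ?m (?C \<inter> ?A)"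
        using cantor.finite_measure_Diff'[of ?C ?A] C A by simp
      ultimately show ?thesis using H[of n] j by linarith
    qed
    then show ?rhs
      using d1 by (intro exI[of _ g]) (simp add: g stage_set_eq_level_set D_def[abs_def])
  }
qed

section \<open>The computation of the measure\<close>

lemma sets_codes: "codes f \<sigma> A \<Longrightarrow> A \<in> sets cantor_measure"
proof (induction rule: codes.induct)
  case (leaf \<sigma> k)
  show ?case by (rule sets_clopen_code)
next
  case (compl \<sigma> A)
  then show ?case using sets.compl_sets[of A cantor_measure] by (simp add: Compl_eq_Diff_UNIV)
next
  case (susl \<sigma> P)
  then show ?case
    unfolding suslinA_eq_bounded_branches[of P "\<lambda>_. 0"]
    by (intro sets_bounded_branches cantor.complete_measure_axioms cantor.finite_measure_axioms) auto
qed

text \<open>A node is given as \<open>w = \<langle>l, \<langle>z, \<langle>\<sigma>, \<langle>c, \<langle>a, b\<rangle>\<rangle>\<rangle>\<rangle>\<rangle>\<close>: its label, the index of the program, its address, and the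
  question whether \<open>\<mu>(clopen_code c - A) < a / (b + 1)\<close>.\<close>
definition leaf_value :: "nat \<Rightarrow> nat" where
  "leaf_value w = (let k = p1 w div 2; p = p2 (p2 (p2 w)); c = p1 p; a = p1 (p2 p); b = p2 (p2 p) in
     of_bool (word_count (c + k) (clopen_code c - clopen_code k) * Suc b < a * 2 ^ (c + k)))"

text \<open>Here \<open>t\<close> is a segment of the witness. At a complement its first entry codes
  the fraction q'. At a Suslin node a segment of length n + 2 asks child \<open>n\<close> whether
  the clopen set in the last entry exceeds it by less than 2^-(j+n+2); denominators are stored minus
  one. Short segments also yield valid queries, since S8 needs a value at every
  \<open>t\<close>.\<close>

definition node_query :: "nat \<Rightarrow> nat" where
  "node_query y = (let t = p1 y; w = p2 y; z = p1 (p2 w); \<sigma> = p1 (p2 (p2 w)); c = p1 (p2 (p2 (p2 w))) in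
     if p1 w = 2 then pair z (pair (snoc_code \<sigma> 0) (pair c (nth_code t 0)))
     else pair z (pair (snoc_code \<sigma> (len_code t - 2)) (pair (p2 (nth_code t (len_code t - 1)))
       (pair 1 (2 ^ (nth_code t 0 + (len_code t - 2) + 2) - 1)))))"

text \<open>Segments too short to carry the data pass. A complement needs the negative answer of its
  child, a Suslin node the positive one. Denominators are cleared, so only natural numbers are
  compared.\<close>

definition node_test :: "nat \<Rightarrow> nat" where
  "node_test y = (let v = p1 y; t = p1 (p2 y); w = p2 (p2 y); p = p2 (p2 (p2 w));
       c = p1 p; a = p1 (p2 p); b = p2 (p2 p); j = nth_code t 0; a' = p1 j; b' = p2 j in
     of_bool (if p1 w = 2
       then len_code t = 0 \<or> v = 0 \<and> word_count c (clopen_code c) * (Suc b' * Suc b) < 2 ^ c * (a' * Suc b + a * Suc b')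
       else len_code t < 2 \<or> v = 1 \<and>
         (word_count (c + t) (clopen_code c - stage_set t) * 2 ^ j + 2 ^ (c + t)) * Suc b < a * (2 ^ (c + t) * 2 ^ j)))"

lemma K1_word_count [krec]:
  assumes "K1 r" "KP (\<lambda>y. bits (p1 y) \<in> X (p2 y))"
  shows "K1 (\<lambda>x. word_count (r x) (X x))"
  unfolding word_count_def by (intro krec assms)

lemma KP_if: "KP P \<Longrightarrow> KP Q \<Longrightarrow> KP R \<Longrightarrow> KP (\<lambda>x. if P x then Q x else R x)"
proof -
  assume a: "KP P" "KP Q" "KP R"
  have eq: "(if A then B else C) \<longleftrightarrow> (A \<longrightarrow> B) \<and> (\<not> A \<longrightarrow> C)" for A B C by auto
  show ?thesis unfolding eq by (intro krec a)
qed

lemma K1_leaf_value: "K1 leaf_value"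
  unfolding leaf_value_def[abs_def] Let_def Diff_iff by (intro krec; (unfold Diff_iff)?; intro krec)

lemma K1_node_query: "K1 node_query"
  unfolding node_query_def[abs_def] Let_def by (intro krec)

lemma K1_node_test: "K1 node_test"
  unfolding node_test_def[abs_def] Let_def by (intro krec KP_if; (unfold Diff_iff)?; intro krec)

lemma Suslin_S_of_bool: "Suslin_S (\<lambda>t. of_bool (P t)) = of_bool (\<exists>g. \<forall>n. P (fbar g n))"
  by (auto simp: Suslin_S_def)

lemma ex_fraction_between:
  assumes "x < y" "0 \<le> (y::real)"
  shows "\<exists>a b. x < real a / real (Suc b) \<and> real a / real (Suc b) \<le> y"
proof (cases "x < 0")
  case True
  with assms(2) show ?thesis by (intro exI[of _ 0]) simp
next
  case False
  obtain r where r: "r \<in> \<rat>" "x < r" "r < y" using Rats_dense_in_real[OF assms(1)] by blast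
  obtain i n where i: "r = of_int i / real n" "n \<noteq> 0"
    using r(1) by (auto simp: Rats_eq_int_div_nat)
  have "0 < r" using False r(2) by linarith
  with i have "0 < i" by (simp add: zero_less_divide_iff)
  with i have "r = real (nat i) / real (Suc (n - 1))" by simp
  with r show ?thesis by (meson less_imp_le)
qed

lemma divide_less_divide_cross: "0 < d \<Longrightarrow> 0 < e \<Longrightarrow> (x::real) / d < y / e \<longleftrightarrow> x * e < y * d"
  by (simp add: field_simps)

lemma frac_less_iff:
  "real m / 2 ^ R < real a / real (Suc b) \<longleftrightarrow> m * Suc b < a * 2 ^ R"
proof -
  have "real m / 2 ^ R < real a / real (Suc b) \<longleftrightarrow> real m * real (Suc b) < real a * 2 ^ R"
    by (rule divide_less_divide_cross) simp_all
  also have "\<dots> \<longleftrightarrow> real (m * Suc b) < real (a * 2 ^ R)"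
    by (simp only: of_nat_mult of_nat_power of_nat_numeral)
  finally show ?thesis unfolding of_nat_less_iff .
qed

lemma frac_add_less_iff:
  "real m / 2 ^ R + 1 / 2 ^ j < real a / real (Suc b) \<longleftrightarrow>
    (m * 2 ^ j + 2 ^ R) * Suc b < a * (2 ^ R * 2 ^ j)"
proof -
  have eq: "real m / 2 ^ R + 1 / 2 ^ j = real (m * 2 ^ j + 2 ^ R) / 2 ^ (R + j)"
    by (simp add: field_simps power_add)
  show ?thesis unfolding eq frac_less_iff by (simp only: power_add)
qed

lemma less_frac_add_iff:
  "real m / 2 ^ R < real a' / real (Suc b') + real a / real (Suc b) \<longleftrightarrow>
    m * (Suc b' * Suc b) < 2 ^ R * (a' * Suc b + a * Suc b')"
proof -
  have eq: "real a' / real (Suc b') + real a / real (Suc b) =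
      real (a' * Suc b + a * Suc b') / real (Suc b' * Suc b)"
    by (simp only: add_frac_eq of_nat_add of_nat_mult of_nat_eq_0_iff nat.distinct not_False_eq_True)
  obtain d where d: "Suc b' * Suc b = Suc d" by simp
  show ?thesis unfolding eq d frac_less_iff by (simp only: mult.commute)
qed

lemma measure_clopen_Diff:
  "measure cantor_measure (clopen_code c - clopen_code k) =
     word_count (c + k) (clopen_code c - clopen_code k) / 2 ^ (c + k)"
  by (intro measure_depends_on depends_on_Diff) (auto intro: depends_on_mono[OF depends_on_clopen_code])

lemma measure_clopen_Diff_stage:
  "measure cantor_measure (clopen_code c - stage_set t) =
     word_count (c + t) (clopen_code c - stage_set t) / 2 ^ (c + t)"
  by (intro measure_depends_on depends_on_Diff)
     (auto intro: depends_on_mono[OF depends_on_clopen_code] depends_on_mono[OF depends_on_stage_set])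

section \<open>Correctness of the recursion at each kind of node\<close>

definition fills :: "nat \<Rightarrow> cantor set \<Rightarrow> nat \<Rightarrow> nat \<Rightarrow> bool" where
  "fills c A a b \<longleftrightarrow> measure cantor_measure (clopen_code c - A) < real a / real (Suc b)"

lemma fills_leaf:
  "leaf_value (pair (Suc (2 * k)) (pair z (pair \<sigma> (pair c (pair a b))))) =
     of_bool (fills c (clopen_code k) a b)"
proof -
  have "Suc (2 * k) div 2 = k" by simp
  then show ?thesis
    by (simp only: leaf_value_def Let_def p_pair fills_def measure_clopen_Diff frac_less_iff)
qed

lemma fills_compl:
  assumes "A \<in> sets cantor_measure" "w = pair 2 (pair z (pair \<sigma> (pair c (pair a b))))"
    and h: "\<And>t. h t = of_bool (fills c A (p1 (nth_code t 0)) (p2 (nth_code t 0)))"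
  shows "Suslin_S (\<lambda>t. node_test (pair (h t) (pair t w))) = of_bool (fills c (- A) a b)"
proof -
  let ?m = "measure cantor_measure" and ?C = "clopen_code c"
  have C: "?C \<in> sets cantor_measure" by (rule sets_clopen_code)
  have mC: "?m ?C = word_count c ?C / 2 ^ c" by (rule measure_depends_on, rule depends_on_clopen_code)
  \<comment> \<open>\<open>j\<close> codes q': the first conjunct says q' \<le> \<mu>(C - A), the
    non-strict form given by a negative answer.\<close>
  define P where "P j \<longleftrightarrow> \<not> fills c A (p1 j) (p2 j) \<and>
     ?m ?C < real (p1 j) / real (Suc (p2 j)) + real a / real (Suc b)" for j
  have node_test: "node_test (pair (h t) (pair t w)) = of_bool (len_code t = 0 \<or> P (nth_code t 0))" for t
    unfolding node_test_def Let_def assms(2) p_pair P_def mC less_frac_add_iff h by simp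
  have "?m (?C - - A) = ?m ?C - ?m (?C - A)"
  proof -
    have "?C - - A = ?C \<inter> A" by auto
    then show ?thesis using cantor.finite_measure_Diff'[OF C assms(1)] by simp
  qed
  then have *: "fills c (- A) a b \<longleftrightarrow> ?m ?C - real a / real (Suc b) < ?m (?C - A)"
    by (auto simp: fills_def)
  have "(\<exists>j. P j) \<longleftrightarrow> fills c (- A) a b"
  proof
    assume "\<exists>j. P j"
    then obtain j where "P j" ..
    then have "\<not> ?m (?C - A) < real (p1 j) / real (Suc (p2 j))"
      "?m ?C < real (p1 j) / real (Suc (p2 j)) + real a / real (Suc b)"
      unfolding P_def fills_def by blast+
    then show "fills c (- A) a b" unfolding * by linarith
  next
    assume "fills c (- A) a b"
    then obtain a' b' where "?m ?C - real a / real (Suc b) < real a' / real (Suc b')"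
        "real a' / real (Suc b') \<le> ?m (?C - A)"
      using ex_fraction_between[of "?m ?C - real a / real (Suc b)" "?m (?C - A)"] * by auto
    then have "P (pair a' b')" by (simp add: P_def fills_def algebra_simps)
    then show "\<exists>j. P j" ..
  qed
  \<comment> \<open>The test reads only the first entry, so a constant witness suffices.\<close>
  moreover have "(\<exists>g. \<forall>n. len_code (fbar g n) = 0 \<or> P (nth_code (fbar g n) 0)) \<longleftrightarrow> (\<exists>j. P j)"
  proof
    assume "\<exists>g. \<forall>n. len_code (fbar g n) = 0 \<or> P (nth_code (fbar g n) 0)"
    then obtain g where "\<forall>n. len_code (fbar g n) = 0 \<or> P (nth_code (fbar g n) 0)" ..
    from spec[OF this, of 1] show "\<exists>j. P j" by auto
  next
    assume "\<exists>j. P j"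
    then obtain j where "P j" ..
    then have "len_code (fbar (\<lambda>_. j) n) = 0 \<or> P (nth_code (fbar (\<lambda>_. j) n) 0)" for n
      by (cases "n = 0") (simp_all add: nth_code_fbar)
    then show "\<exists>g. \<forall>n. len_code (fbar g n) = 0 \<or> P (nth_code (fbar g n) 0)" by blast
  qed
  ultimately show ?thesis unfolding node_test Suslin_S_of_bool by simp
qed

lemma fills_susl:
  assumes "\<And>i. Q i \<in> sets cantor_measure" "w = pair 4 (pair z (pair \<sigma> (pair c (pair a b))))"
    and h: "\<And>t. h t = of_bool (fills (p2 (nth_code t (len_code t - 1))) (Q (len_code t - 2))
              1 (2 ^ (nth_code t 0 + (len_code t - 2) + 2) - 1))"
  shows "Suslin_S (\<lambda>t. node_test (pair (h t) (pair t w))) = of_bool (fills c (bounded_branches H0 0 Q) a b)"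
proof -
  let ?m = "measure cantor_measure" and ?C = "clopen_code c"
  define P where "P t \<longleftrightarrow>
    ?m (clopen_code (p2 (nth_code t (len_code t - 1))) - Q (len_code t - 2)) < 1 / 2 ^ (nth_code t 0 + (len_code t - 2) + 2) \<and>
    ?m (?C - stage_set t) + 1 / 2 ^ nth_code t 0 < real a / real (Suc b)" for t
  have pow: "real (Suc (2 ^ n - 1)) = 2 ^ n" for n by (simp add: of_nat_diff)
  have node_test: "node_test (pair (h t) (pair t w)) = of_bool (len_code t < 2 \<or> P t)" for t
    unfolding node_test_def Let_def assms(2) p_pair P_def measure_clopen_Diff_stage frac_add_less_iff
      h fills_def pow by simp
  \<comment> \<open>Segments of length 0 and 1 pass automatically, which shifts the index by
    two.\<close>
  have "(\<exists>g. \<forall>n. len_code (fbar g n) < 2 \<or> P (fbar g n)) \<longleftrightarrow> (\<exists>g. \<forall>n. P (fbar g (Suc (Suc n))))"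
  proof (intro ex_cong1 iffI allI)
    fix g n assume "\<forall>n. len_code (fbar g n) < 2 \<or> P (fbar g n)"
    from spec[OF this, of "Suc (Suc n)"] show "P (fbar g (Suc (Suc n)))" by simp
  next
    fix g n assume *: "\<forall>n. P (fbar g (Suc (Suc n)))"
    show "len_code (fbar g n) < 2 \<or> P (fbar g n)"
    proof (cases "n < 2")
      case False
      then obtain k where "n = Suc (Suc k)" by (metis One_nat_def Suc_1 less_2_cases_iff not0_implies_Suc)
      with * show ?thesis by blast
    qed simp
  qed
  also have "\<dots> \<longleftrightarrow> fills c (bounded_branches H0 0 Q) a b"
    unfolding fills_def measure_minus_bounded_branches_less_iff[OF assms(1)]
    by (simp add: P_def nth_code_fbar)
  finally show ?thesis unfolding node_test Suslin_S_of_bool by simp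
qed

text \<open>Induction on the well-founded code: the hypothesis for the children supplies the
  convergence of every query that S8 demands.\<close>

lemma fills_computable:
  "\<exists>E. \<forall>f \<sigma> A c a b. codes f \<sigma> A \<longrightarrow>
     computes E f (pair (enc E) (pair (list_encode \<sigma>) (pair c (pair a b)))) (of_bool (fills c A a b))"
proof -
  \<comment> \<open>The address is the first field after the program index; odd labels mark
    leaves.\<close>
  have nd: "K1 (\<lambda>x. p1 (p2 x))" and b: "K1 (\<lambda>w. of_bool (\<not> odd (p1 w)))" by (intro krec)+
  obtain E where E: "\<And>f r w. w = pair (f (p1 (p2 (pair (enc E) r)))) (pair (enc E) r) \<Longrightarrow>
    (of_bool (\<not> odd (p1 w)) = (0::nat) \<longrightarrow> computes E f (pair (enc E) r) (leaf_value w)) \<and>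
    (\<forall>q h. of_bool (\<not> odd (p1 w)) = (1::nat) \<longrightarrow> (\<forall>t. node_query (pair t w) = pair (enc E) (q t)) \<longrightarrow>
        (\<forall>t. computes E f (pair (enc E) (q t)) (h t)) \<longrightarrow>
        computes E f (pair (enc E) r) (Suslin_S (\<lambda>t. node_test (pair (h t) (pair t w)))))"
    using computes_rec[OF nd b K1_leaf_value K1_node_query K1_node_test] by blast
  have "computes E f (pair (enc E) (pair (list_encode \<sigma>) (pair c (pair a b)))) (of_bool (fills c A a b))"
    if "codes f \<sigma> A" for f \<sigma> A c a b
    using that
  proof (induction arbitrary: c a b rule: codes.induct)
    case (leaf \<sigma> k)
    show ?case
      using E[OF refl, of f "pair (list_encode \<sigma>) (pair c (pair a b))"] leaf
      by (simp add: fills_leaf)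
  next
    case (compl \<sigma> A)
    let ?r = "pair (list_encode \<sigma>) (pair c (pair a b))"
    let ?w = "pair 2 (pair (enc E) ?r)"
    let ?q = "\<lambda>t. pair (list_encode (\<sigma> @ [0])) (pair c (nth_code t 0))"
    let ?h = "\<lambda>t. of_bool (fills c A (p1 (nth_code t 0)) (p2 (nth_code t 0)))"
    have w: "?w = pair (f (p1 (p2 (pair (enc E) ?r)))) (pair (enc E) ?r)" using compl by simp
    have q: "node_query (pair t ?w) = pair (enc E) (?q t)" for t
      by (simp add: node_query_def snoc_code_def)
    have h: "computes E f (pair (enc E) (?q t)) (?h t)" for t
      using compl.IH[of c "p1 (nth_code t 0)" "p2 (nth_code t 0)"] by simp
    have "computes E f (pair (enc E) ?r) (Suslin_S (\<lambda>t. node_test (pair (?h t) (pair t ?w))))"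
      by (rule E[of ?w f ?r, OF w, THEN conjunct2, rule_format, of ?q ?h]) (simp, rule q, rule h)
    then show ?case
      using fills_compl[OF sets_codes[OF compl.hyps(2)] refl, of ?h] by simp
  next
    case (susl \<sigma> P)
    let ?r = "pair (list_encode \<sigma>) (pair c (pair a b))"
    let ?w = "pair 4 (pair (enc E) ?r)"
    define Q where "Q i = P (list_decode i)" for i
    have Q: "codes f (\<sigma> @ [i]) (Q i)"
      "computes E f (pair (enc E) (pair (list_encode (\<sigma> @ [i])) (pair c' (pair a' b')))) (of_bool (fills c' (Q i) a' b'))"
      for i c' a' b'
      using susl.IH[rule_format, of "list_decode i"] by (simp_all add: Q_def)
    let ?q = "\<lambda>t. pair (list_encode (\<sigma> @ [len_code t - 2])) (pair (p2 (nth_code t (len_code t - 1)))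
       (pair 1 (2 ^ (nth_code t 0 + (len_code t - 2) + 2) - 1)))"
    let ?h = "\<lambda>t. of_bool (fills (p2 (nth_code t (len_code t - 1))) (Q (len_code t - 2))
              1 (2 ^ (nth_code t 0 + (len_code t - 2) + 2) - 1))"
    have w: "?w = pair (f (p1 (p2 (pair (enc E) ?r)))) (pair (enc E) ?r)" using susl by simp
    have q: "node_query (pair t ?w) = pair (enc E) (?q t)" for t
      by (simp add: node_query_def snoc_code_def)
    have h: "computes E f (pair (enc E) (?q t)) (?h t)" for t by (rule Q(2))
    have "computes E f (pair (enc E) ?r) (Suslin_S (\<lambda>t. node_test (pair (?h t) (pair t ?w))))"
      by (rule E[of ?w f ?r, OF w, THEN conjunct2, rule_format, of ?q ?h]) (simp, rule q, rule h)
    moreover have "suslinA P = bounded_branches (\<lambda>_. 0) 0 Q" unfolding Q_def by (rule suslinA_eq_bounded_branches)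
    ultimately show ?case
      using fills_susl[of Q ?w "enc E" "list_encode \<sigma>" c a b ?h "\<lambda>_. 0",
          OF sets_codes[OF Q(1)] refl refl] by (simp only:)
  qed
  then show ?thesis by blast
qed

text \<open>With the whole space as clopen set, q < \<mu>(A) means \<mu>(C - A) < 1 - q; the
  numerator is that of 1 - q, truncated at 0.\<close>

lemma less_measure_iff_fills:
  assumes "A \<in> sets cantor_measure" "clopen_code c = UNIV"
  shows "real_of_rat (qdec n) < measure cantor_measure A \<longleftrightarrow>
    fills c A (if p1 (p1 n) = 0 then Suc (p2 n) - p2 (p1 n) else Suc (p2 n) + p2 (p1 n)) (p2 n)"
    (is "_ \<longleftrightarrow> fills c A ?a ?b")
proof -
  define s u where "s = p1 (p1 n)" and "u = p2 (p1 n)"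
  have q: "qdec n = (if s = 0 then 1 else - 1) * of_nat u / of_nat (Suc ?b)"
    by (simp add: qdec_def s_def u_def p1_def p2_def split: prod.split)
  have "measure cantor_measure (UNIV - A) = 1 - measure cantor_measure A"
    using cantor.prob_compl[OF assms(1)] by simp
  then have 1: "fills c A a b \<longleftrightarrow> 1 - real a / real (Suc b) < measure cantor_measure A" for a b
    unfolding fills_def assms(2) by linarith
  show ?thesis
  proof (cases "s = 0")
    case s: True
    show ?thesis
    proof (cases "u \<le> Suc ?b")
      case True
      then have "1 - real ?a / real (Suc ?b) = real_of_rat (qdec n)"
        using s by (simp add: q s_def[symmetric] u_def[symmetric] of_nat_diff of_rat_divide field_simps del: of_nat_Suc)
      then show ?thesis unfolding 1 by simp
    next
      case False
      \<comment> \<open>Truncation takes effect only here, and both sides are false because \<mu>(A)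
        \<le> 1.\<close>
      then have "real_of_rat (qdec n) \<ge> 1"
        using s by (simp add: q of_rat_divide field_simps del: of_nat_Suc)
      moreover have "measure cantor_measure A \<le> 1" by simp
      moreover have a: "?a = 0" using False s by (simp add: s_def[symmetric] u_def[symmetric])
      ultimately show ?thesis unfolding 1 a by (simp only: of_nat_0 div_0 diff_zero) linarith
    qed
  next
    case False
    then have "real ?a = real (Suc ?b) + real u" by (simp add: s_def u_def)
    then have "1 - real ?a / real (Suc ?b) = real_of_rat (qdec n)"
      using False by (simp add: q of_rat_divide of_rat_minus add_divide_distrib del: of_nat_Suc)
    then show ?thesis unfolding 1 by simp
  qed
qed

theorem theorem2p10:
  shows "\<exists>e::nat. \<forall>f A. codes f [] A \<longrightarrow>
           (\<forall>n. kleene e [O2 Suslin_S, O1 f, O0 n]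
                  (if real_of_rat (qdec n) < measure cantor_measure A then 0 else 1))"
proof -
  have "depends_on 0 UNIV" by (simp add: depends_on_def)
  then obtain c where c: "clopen_code c = UNIV" using ex_clopen_code by blast
  obtain E where E: "\<And>f A a b. codes f [] A \<Longrightarrow>
     computes E f (pair (enc E) (pair 0 (pair c (pair a b)))) (of_bool (fills c A a b))"
    using fills_computable by (metis list_encode.simps(1))
  define num where
    "num n = (if p1 (p1 n) = 0 then Suc (p2 n) - p2 (p1 n) else Suc (p2 n) + p2 (p1 n))" for n
  \<comment> \<open>\<open>E\<close> is fixed by now, so its index enters the input as a constant;
    the address 0 is the root.\<close>
  have "K1 (\<lambda>n. pair (enc E) (pair 0 (pair c (pair (num n) (p2 n)))))"
    unfolding num_def by (intro krec)
  then obtain e1 where e1: "\<And>f n. computes e1 f n (pair (enc E) (pair 0 (pair c (pair (num n) (p2 n)))))"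
    using computes_K1 by blast
  \<comment> \<open>The required output is 0 for true, opposite to \<open>of_bool\<close>.\<close>
  have "K1 (\<lambda>v. 1 - v)" by (intro krec)
  then obtain e2 where e2: "\<And>f v. computes e2 f v (1 - v)" using computes_K1 by blast
  obtain e3 where e3: "\<And>f n v. computes E f (pair (enc E) (pair 0 (pair c (pair (num n) (p2 n))))) v \<Longrightarrow> computes e3 f n v"
    using computes_comp[of e1 E] e1 by blast
  obtain e4 where e4: "\<And>f n v. computes e3 f n v \<Longrightarrow> computes e4 f n (1 - v)"
    using computes_comp[of e3 e2] e2 by blast
  \<comment> \<open>Two swaps bring the numeric argument from the last place to the front.\<close>
  have "kc (KPerm 1 (KPerm 0 e4)) [O2 Suslin_S, O1 f, O0 n]
      (if real_of_rat (qdec n) < measure cantor_measure A then 0 else 1)" if "codes f [] A" for f A n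
  proof -
    let ?v = "if real_of_rat (qdec n) < measure cantor_measure A then 0 else 1 :: nat"
    have "1 - of_bool (fills c A (num n) (p2 n)) = ?v"
      using less_measure_iff_fills[OF sets_codes[OF that] c, of n] by (simp add: num_def)
    then have "computes e4 f n ?v" using e4[OF e3[OF E[OF that]]] by metis
    then have "kc e4 [O0 n, O2 Suslin_S, O1 f] ?v" by (simp add: computes_def)
    then show ?thesis
      by (intro kc_perm[of "KPerm 0 e4" "[O2 Suslin_S, O0 n, O1 f]"]
            kc_perm[of e4 "[O0 n, O2 Suslin_S, O1 f]"]) (simp_all add: swap_at_def)
  qed
  then show ?thesis unfolding kleene_def by blast
qed

end
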